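(* Let $n=1$ and $m\in(0,1)$. Then \[ \sup_{f\in H^s(\mathbb R)}\dim_H\mathfrak D(f)\leq\max\left\{1-2s,\ \frac12+\frac{1-4s}{2(1-m)}\right\} \] whenever $s\in\left(\frac m4,\frac12\right)$.
   Context: $n$ is the spatial dimension and $\dim_H$ denotes Hausdorff dimension. $H^s(\mathbb R^n)$ is the inhomogeneous Sobolev space with norm $\|f\|_{H^s(\mathbb R^n)}=\|(1-\Delta)^{s/2}f\|_{L^2(\mathbb R^n)}$. For $m\in(0,\infty)$, the solution to the Schrödinger-type equation $i\partial_tu+(-\Delta)^{m/2}u=0$ on $\mathbb R^n\times\mathbb R$ with initial data $u(x,0)=f(x)$ is (formally) given by \[ u(x,t)=e^{it(-\Delta)^{m/2}}f(x)=(2\pi)^{-n}\int_{\mathbb R^n}e^{i(x\cdot\xi+t|\xi|^m)}\widehat f(\xi)\,d\xi , \] where $\widehat f$ is the Fourier transform of $f$. For each $f\in H^s(\mathbb R^n)$, the divergence set $\mathfrak D(f)$ is the set on which the pointwise convergence of the solution to the initial data fails, namely \[ \mathfrak D(f):=\{x\in\mathbb R^n:\ \lim_{t\to0}e^{it(-\Delta)^{m/2}}f(x)\neq f(x)\}. \] *)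

theory Defs
  imports "HOL-Analysis.Analysis"
begin

subsection \<open>Hausdorff measure and dimension\<close>

(* Used for 0 < a only, so the value of 0 powr 0 plays no role. The covering sets are
   required to be bounded because "diameter" has no meaningful value on unbounded sets. *)
definition hausdorff_premeasure :: "real \<Rightarrow> real \<Rightarrow> 'a::metric_space set \<Rightarrow> ennreal" where
  "hausdorff_premeasure \<delta> a A =
     (INF U\<in>{U :: nat \<Rightarrow> 'a set. A \<subseteq> (\<Union>i. U i) \<and> (\<forall>i. bounded (U i) \<and> diameter (U i) \<le> \<delta>)}.
        \<Sum>i. ennreal (diameter (U i) powr a))"

definition hausdorff_measure :: "real \<Rightarrow> 'a::metric_space set \<Rightarrow> ennreal" where
  "hausdorff_measure a A = (SUP \<delta>\<in>{0<..}. hausdorff_premeasure \<delta> a A)"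

definition hausdorff_dim :: "'a::metric_space set \<Rightarrow> ereal" where
  "hausdorff_dim A = (INF a\<in>{a. 0 < a \<and> hausdorff_measure a A = 0}. ereal a)"

subsection \<open>The Fourier transform on the space of square integrable functions\<close>

definition square_integrable :: "('a::euclidean_space \<Rightarrow> complex) \<Rightarrow> bool" where
  "square_integrable f \<longleftrightarrow>
     f \<in> borel_measurable lebesgue \<and> integrable lebesgue (\<lambda>x. (norm (f x))\<^sup>2)"

(* Plancherel's definition: g is the limit in mean square of the truncated integrals,
   normalised as the integral of exp (-i x.xi) f(x) dx. *)
definition is_fourier_transform ::
    "('a::euclidean_space \<Rightarrow> complex) \<Rightarrow> ('a \<Rightarrow> complex) \<Rightarrow> bool" where
  "is_fourier_transform f g \<longleftrightarrow> square_integrable g \<and>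
     ((\<lambda>R::real. \<integral>\<^sup>+\<xi>. ennreal ((norm (g \<xi> -
          (LINT x:cball 0 R|lebesgue. cis (- (x \<bullet> \<xi>)) * f x)))\<^sup>2) \<partial>lebesgue) \<longlongrightarrow> 0) at_top"

(* For square integrable f this is determined up to a Lebesgue null set. Below it occurs only
   in integrals and in conditions that do not change on null sets. *)
definition fourier :: "('a::euclidean_space \<Rightarrow> complex) \<Rightarrow> 'a \<Rightarrow> complex" where
  "fourier f = (SOME g. is_fourier_transform f g)"

(* For s \<ge> 0: membership in H^s, i.e. (1 - Laplacian)^(s/2) f is in L^2. *)
definition sobolev :: "real \<Rightarrow> ('a::euclidean_space \<Rightarrow> complex) set" where
  "sobolev s = {f. square_integrable f \<and>
     square_integrable (\<lambda>\<xi>. (1 + (norm \<xi>)\<^sup>2) powr (s / 2) * fourier f \<xi>)}"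

subsection \<open>Pointwise values\<close>

(* The inversion integral of h at x, which need not converge absolutely for square integrable h,
   is the limit of the integrals over balls. The predicate says that it converges to v. *)
definition has_inverse_fourier ::
    "('a::euclidean_space \<Rightarrow> complex) \<Rightarrow> 'a \<Rightarrow> complex \<Rightarrow> bool" where
  "has_inverse_fourier h x v \<longleftrightarrow>
     ((\<lambda>R::real. (1 / (2 * pi) ^ DIM('a)) *\<^sub>R (LINT \<xi>:cball 0 R|lebesgue. cis (x \<bullet> \<xi>) * h \<xi>))
        \<longlongrightarrow> v) at_top"

(* v is the value at the point x and time t of the solution with initial data f *)
definition has_solution_value ::
    "real \<Rightarrow> ('a::euclidean_space \<Rightarrow> complex) \<Rightarrow> 'a \<Rightarrow> real \<Rightarrow> complex \<Rightarrow> bool" where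
  "has_solution_value m f x t v \<longleftrightarrow>
     has_inverse_fourier (\<lambda>\<xi>. cis (t * norm \<xi> powr m) * fourier f \<xi>) x v"

(* An element of H^s is a class of functions modulo null sets, whereas the dimension of the
   divergence set depends on the representative. The representative is fixed by the same formula
   that gives the pointwise values of the solution: f(x) is the value of the formula at t = 0
   wherever that value exists. *)
definition canonical_representative :: "('a::euclidean_space \<Rightarrow> complex) \<Rightarrow> bool" where
  "canonical_representative f \<longleftrightarrow> (\<forall>x v. has_inverse_fourier (fourier f) x v \<longrightarrow> f x = v)"

(* Points where the solution has no value for times arbitrarily close to 0, or where its limit
   does not exist, also belong to the divergence set. *)
definition divergence_set :: "real \<Rightarrow> ('a::euclidean_space \<Rightarrow> complex) \<Rightarrow> 'a set" where
  "divergence_set m f = {x. \<not> (\<exists>u. (\<forall>\<^sub>F t in at 0. has_solution_value m f x t (u t)) \<and>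
                                  (u \<longlongrightarrow> f x) (at 0))}"

end

theory Submission
  imports Defs
begin

text \<open>
  For each dyadic frequency band \<open>2\<^sup>k < \<bar>\<xi>\<bar> \<le> 2\<^sup>k\<^sup>+\<^sup>1\<close> consider the set of points where some truncation of
  the band, at some time \<open>\<bar>t\<bar> \<le> 1\<close>, is large. On a finite net of this set put weights that are maximal
  subject to \<open>w (ball x r) \<le> r\<^sup>a\<close>; by maximality every point lies in a ball where equality holds, so by
  Vitali's lemma the total weight controls the \<open>a\<close>-dimensional content. By the \<open>TT\<^sup>*\<close> method
  the total weight is controlled by the row sums of the kernel
  \<open>\<integral> exp (i ((x - y) \<xi> + (t - t') \<bar>\<xi>\<bar>\<^sup>m)) d\<xi>\<close> over the band. With \<open>N = 2\<^sup>k\<close> and \<open>d = \<bar>x - y\<bar>\<close>,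
  van der Corput's lemmas bound it by \<open>1 / d\<close>, plus \<open>(N / d)\<^sup>1\<^sup>/\<^sup>2\<close> when \<open>d\<close> is at most of the order
  \<open>N\<^sup>m\<^sup>-\<^sup>1\<close>, because otherwise the phase has no stationary point. The row sums are thus
  at most of the order \<open>k N\<^sup>\<gamma>\<close>, where \<open>\<gamma>\<close> is the maximum of \<open>1 - a\<close> and \<open>1/2 - (1 - m) (a - 1/2)\<close>,
  and \<open>\<gamma> < 2 s\<close> is exactly the condition that \<open>a\<close> exceeds the claimed bound. A Borel-Cantelli
  argument finishes the proof: off a set of \<open>a\<close>-dimensional measure zero the truncated integrals
  converge uniformly in \<open>\<bar>t\<bar> \<le> 1\<close>, so the solution exists and is continuous in \<open>t\<close>.
\<close>

subsection \<open>Hausdorff measure\<close>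

lemma hausdorff_premeasure_mono:
  "A \<subseteq> B \<Longrightarrow> hausdorff_premeasure \<delta> a A \<le> hausdorff_premeasure \<delta> a B"
  unfolding hausdorff_premeasure_def by (intro INF_superset_mono) auto

lemma hausdorff_premeasure_UN_le:
  fixes A :: "nat \<Rightarrow> 'a::metric_space set"
  shows "hausdorff_premeasure \<delta> a (\<Union>i. A i) \<le> (\<Sum>i. hausdorff_premeasure \<delta> a (A i))"
proof (cases "(\<Sum>i. hausdorff_premeasure \<delta> a (A i)) = top")
  case False
  define \<U> where "\<U> A = {U :: nat \<Rightarrow> 'a set. A \<subseteq> (\<Union>i. U i) \<and> (\<forall>i. bounded (U i) \<and> diameter (U i) \<le> \<delta>)}" for A
  have hp: "hausdorff_premeasure \<delta> a A = (INF U\<in>\<U> A. \<Sum>i. ennreal (diameter (U i) powr a))" for A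
    by (simp add: hausdorff_premeasure_def \<U>_def)
  show ?thesis
  proof (rule ennreal_le_epsilon)
    fix e :: real assume "0 < e"
    \<comment> \<open>Near-optimal covers with geometrically decreasing errors that add up to
      \<open>e\<close>. Finiteness of the total makes each summand finite, so that adding an error
      gives a strictly larger number.\<close>
    have "\<exists>U\<in>\<U> (A n). (\<Sum>i. ennreal (diameter (U i) powr a)) < hausdorff_premeasure \<delta> a (A n) + ennreal (e * (1/2) ^ Suc n)" for n
    proof -
      have "hausdorff_premeasure \<delta> a (A n) \<noteq> top"
        using False ennreal_suminf_lessD[of "\<lambda>i. hausdorff_premeasure \<delta> a (A i)" top n] by (auto simp: top.not_eq_extremum)
      then have "hausdorff_premeasure \<delta> a (A n) < hausdorff_premeasure \<delta> a (A n) + ennreal (e * (1/2) ^ Suc n)"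
        using \<open>0 < e\<close> by (simp add: ennreal_add_left_cancel_less top.not_eq_extremum)
      then show ?thesis unfolding hp INF_less_iff .
    qed
    then obtain U where U: "\<And>n. U n \<in> \<U> (A n)"
      "\<And>n. (\<Sum>i. ennreal (diameter (U n i) powr a)) \<le> hausdorff_premeasure \<delta> a (A n) + ennreal (e * (1/2) ^ Suc n)"
      by (metis less_imp_le)
    define V where "V = case_prod U \<circ> prod_decode"
    have "V \<in> \<U> (\<Union>i. A i)"
    proof -
      have "(\<Union>i. A i) \<subseteq> (\<Union>i. V i)"
      proof
        fix x assume "x \<in> (\<Union>i. A i)"
        then obtain n where "x \<in> A n" by blast
        then obtain i where "x \<in> U n i" using U(1)[of n] by (auto simp: \<U>_def)
        then have "x \<in> V (prod_encode (n, i))" by (simp add: V_def)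
        then show "x \<in> (\<Union>i. V i)" by blast
      qed
      moreover have "bounded (V i) \<and> diameter (V i) \<le> \<delta>" for i
        using U(1) by (auto simp: V_def \<U>_def split: prod.split)
      ultimately show ?thesis by (simp add: \<U>_def)
    qed
    then have "hausdorff_premeasure \<delta> a (\<Union>i. A i) \<le> (\<Sum>i. ennreal (diameter (V i) powr a))"
      unfolding hp by (rule INF_lower)
    also have "\<dots> = (\<Sum>i. (\<lambda>p. ennreal (diameter (case_prod U p) powr a)) (prod_decode i))"
      by (simp add: V_def)
    also have "\<dots> = (\<Sum>n. \<Sum>i. ennreal (diameter (U n i) powr a))"
      by (rule suminf_ennreal_2dimen) simp
    also have "\<dots> \<le> (\<Sum>n. hausdorff_premeasure \<delta> a (A n) + ennreal (e * (1/2) ^ Suc n))"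
      by (intro suminf_le U(2) summableI)
    also have "\<dots> = (\<Sum>n. hausdorff_premeasure \<delta> a (A n)) + (\<Sum>n. ennreal e * ennreal ((1/2) ^ Suc n))"
      using \<open>0 < e\<close> by (subst suminf_add[symmetric])
                       (auto simp del: ennreal_suminf_cmult simp add: ennreal_mult[symmetric])
    also have "\<dots> = (\<Sum>n. hausdorff_premeasure \<delta> a (A n)) + ennreal e"
      unfolding ennreal_suminf_cmult
      by (subst suminf_ennreal_eq[OF zero_le_power power_half_series]) auto
    finally show "hausdorff_premeasure \<delta> a (\<Union>i. A i) \<le> (\<Sum>n. hausdorff_premeasure \<delta> a (A n)) + ennreal e" .
  qed
qed simp

lemma hausdorff_premeasure_le_finite_cover:
  fixes A :: "'a::metric_space set"
  assumes "finite T" "A \<subseteq> (\<Union>i\<in>T. U i)" "\<And>i. i \<in> T \<Longrightarrow> bounded (U i) \<and> diameter (U i) \<le> \<delta>" "0 \<le> \<delta>"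
  shows "hausdorff_premeasure \<delta> a A \<le> ennreal (\<Sum>i\<in>T. diameter (U i) powr a)"
proof -
  obtain f where f: "bij_betw f {..<card T} T"
    using ex_bij_betw_nat_finite[OF assms(1)] by (auto simp: atLeast0LessThan)
  \<comment> \<open>Padding by empty sets turns the finite family into a sequence. They have
    diameter 0, contribute \<open>0 powr a = 0\<close>, and satisfy the diameter bound because
    \<open>0 \<le> \<delta>\<close>.\<close>
  define V where "V n = (if n < card T then U (f n) else {})" for n
  have fT: "f n \<in> T" if "n < card T" for n using f that by (auto simp: bij_betw_def)
  have "A \<subseteq> (\<Union>n. V n)"
  proof
    fix x assume "x \<in> A"
    then obtain i where "i \<in> T" "x \<in> U i" using assms(2) by blast
    then obtain n where "n < card T" "f n = i" using f by (force simp: bij_betw_def)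
    then show "x \<in> (\<Union>n. V n)" using \<open>x \<in> U i\<close> by (intro UN_I[of n]) (auto simp: V_def)
  qed
  moreover have "bounded (V n) \<and> diameter (V n) \<le> \<delta>" for n
    using assms(3)[OF fT] assms(4) by (auto simp: V_def)
  ultimately have "hausdorff_premeasure \<delta> a A \<le> (\<Sum>n. ennreal (diameter (V n) powr a))"
    unfolding hausdorff_premeasure_def by (intro INF_lower) auto
  also have "\<dots> = (\<Sum>n<card T. ennreal (diameter (V n) powr a))"
    by (rule suminf_finite) (auto simp: V_def)
  also have "\<dots> = (\<Sum>n<card T. ennreal (diameter (U (f n)) powr a))"
    by (rule sum.cong) (auto simp: V_def)
  also have "\<dots> = (\<Sum>i\<in>T. ennreal (diameter (U i) powr a))"
    by (rule sum.reindex_bij_betw[OF f])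
  finally show ?thesis by (simp add: sum_ennreal)
qed

text \<open>A small content forces small radii: one term of the sum of \<open>r powr a\<close> is at
  most the whole sum, hence \<open>12 * r \<le> \<delta>\<close> for every ball. So covers found
  without any control of their diameters can be used at scale \<open>\<delta>\<close>. The factor 12
  comes from the diameter of a ball of radius \<open>6 * r\<close>.\<close>

lemma hausdorff_premeasure_le_balls:
  fixes A :: "'a::euclidean_space set"
  assumes "0 < a" "finite T" "\<And>c r. (c, r) \<in> T \<Longrightarrow> 0 < r" "A \<subseteq> (\<Union>(c,r)\<in>T. ball c (6 * r))"
    and c: "(\<Sum>(c,r)\<in>T. r powr a) \<le> \<epsilon>" and "0 \<le> \<delta>" and \<delta>: "12 powr a * \<epsilon> \<le> \<delta> powr a"
  shows "hausdorff_premeasure \<delta> a A \<le> ennreal (12 powr a * \<epsilon>)"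
proof -
  let ?U = "\<lambda>p. ball (fst p) (6 * snd p) :: 'a set"
  have diam: "0 \<le> diameter (?U p)" "diameter (?U p) \<le> 12 * snd p" if "p \<in> T" for p
  proof -
    show "0 \<le> diameter (?U p)" by (rule diameter_ge_0) simp
    have "0 < snd p" using assms(3)[of "fst p" "snd p"] that by simp
    show "diameter (?U p) \<le> 12 * snd p"
    proof (rule diameter_le)
      fix x y assume "x \<in> ?U p" "y \<in> ?U p"
      then have "dist x y \<le> 12 * snd p"
        using dist_triangle[of x y "fst p"] by (simp add: dist_commute)
      then show "norm (x - y) \<le> 12 * snd p" by (simp add: dist_norm)
    qed (use \<open>0 < snd p\<close> in simp)
  qed
  have pw: "(12 * snd p) powr a = 12 powr a * snd p powr a" if "p \<in> T" for p
    using assms(3)[of "fst p" "snd p"] that by (simp add: powr_mult)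
  have "hausdorff_premeasure \<delta> a A \<le> ennreal (\<Sum>p\<in>T. diameter (?U p) powr a)"
  proof (rule hausdorff_premeasure_le_finite_cover[OF \<open>finite T\<close> _ _ \<open>0 \<le> \<delta>\<close>])
    show "A \<subseteq> (\<Union>p\<in>T. ?U p)" using assms(4) by (simp add: case_prod_beta)
    fix p assume p: "p \<in> T"
    have "snd p powr a \<le> (\<Sum>(c,r)\<in>T. r powr a)"
      unfolding case_prod_beta using p assms(2) by (intro member_le_sum) auto
    then have "12 powr a * snd p powr a \<le> 12 powr a * \<epsilon>" using c by (intro mult_left_mono) auto
    then have le: "(12 * snd p) powr a \<le> \<delta> powr a" using \<delta> pw[OF p] by linarith
    have "12 * snd p \<le> \<delta>"
    proof (rule ccontr)
      assume "\<not> 12 * snd p \<le> \<delta>"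
      then have "\<delta> powr a < (12 * snd p) powr a" using assms(1,6) by (intro powr_less_mono2) auto
      then show False using le by simp
    qed
    then show "bounded (?U p) \<and> diameter (?U p) \<le> \<delta>" using diam(2)[OF p] by simp
  qed
  also have "\<dots> \<le> ennreal (12 powr a * \<epsilon>)"
  proof (rule ennreal_leI)
    have "(\<Sum>p\<in>T. diameter (?U p) powr a) \<le> (\<Sum>p\<in>T. (12 * snd p) powr a)"
      using diam assms(1) by (intro sum_mono powr_mono2) auto
    also have "\<dots> = 12 powr a * (\<Sum>(c,r)\<in>T. r powr a)"
      by (simp add: pw sum_distrib_left case_prod_beta)
    also have "\<dots> \<le> 12 powr a * \<epsilon>" using c by (intro mult_left_mono) auto
    finally show "(\<Sum>p\<in>T. diameter (?U p) powr a) \<le> 12 powr a * \<epsilon>" .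
  qed
  finally show ?thesis .
qed

lemma hausdorff_measure_eq_0_iff:
  "hausdorff_measure a A = 0 \<longleftrightarrow> (\<forall>\<delta>>0. hausdorff_premeasure \<delta> a A = 0)"
proof -
  have "hausdorff_measure a A = 0 \<longleftrightarrow> hausdorff_measure a A \<le> 0" by simp
  then show ?thesis unfolding hausdorff_measure_def SUP_le_iff by auto
qed

lemma hausdorff_measure_UN_eq_0:
  fixes A :: "nat \<Rightarrow> 'a::metric_space set"
  assumes "\<And>i. hausdorff_measure a (A i) = 0"
  shows "hausdorff_measure a (\<Union>i. A i) = 0"
  unfolding hausdorff_measure_eq_0_iff
proof (intro allI impI)
  fix \<delta> :: real assume "0 < \<delta>"
  then have "hausdorff_premeasure \<delta> a (A i) = 0" for i
    using assms by (simp add: hausdorff_measure_eq_0_iff)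
  then show "hausdorff_premeasure \<delta> a (\<Union>i. A i) = 0"
    using hausdorff_premeasure_UN_le[of \<delta> a A] by simp
qed

text \<open>The Borel-Cantelli lemma for Hausdorff measure. \<open>A\<close> lies in every tail
  union of the \<open>E k\<close>, and the tails of \<open>c\<close> tend to 0. Since
  \<open>c k\<close> tends to 0 as well, the covers of \<open>E k\<close> are eventually admissible
  for any given \<open>\<delta>\<close>.\<close>

lemma hausdorff_measure_limsup_eq_0:
  fixes E :: "nat \<Rightarrow> 'a::euclidean_space set"
  assumes a: "0 < a" and c: "summable c"
    and cover: "\<And>k. \<exists>T. finite T \<and> (\<forall>(c,r)\<in>T. 0 < r) \<and> E k \<subseteq> (\<Union>(c,r)\<in>T. ball c (6 * r)) \<and> (\<Sum>(c,r)\<in>T. r powr a) \<le> c k"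
    and A: "\<And>K. A \<subseteq> (\<Union>k. E (k + K))"
  shows "hausdorff_measure a A = 0"
  unfolding hausdorff_measure_eq_0_iff
proof (intro allI impI)
  fix \<delta> :: real assume "0 < \<delta>"
  have c0: "0 \<le> c k" for k
  proof -
    obtain T :: "('a \<times> real) set" where "(\<Sum>(c,r)\<in>T. r powr a) \<le> c k" using cover[of k] by blast
    then show ?thesis by (rule order_trans[rotated]) (auto intro!: sum_nonneg)
  qed
  have "(\<lambda>k. 12 powr a * c k) \<longlonglongrightarrow> 12 powr a * 0"
    using summable_LIMSEQ_zero[OF c] by (intro tendsto_intros)
  then have "\<forall>\<^sub>F k in sequentially. 12 powr a * c k < \<delta> powr a"
    by (rule order_tendstoD(2)) (use \<open>0 < \<delta>\<close> in auto)
  then obtain K0 where K0: "\<And>k. K0 \<le> k \<Longrightarrow> 12 powr a * c k < \<delta> powr a"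
    by (auto simp: eventually_sequentially)
  have pre: "hausdorff_premeasure \<delta> a (E k) \<le> ennreal (12 powr a * c k)" if k: "K0 \<le> k" for k
  proof -
    obtain T where T: "finite T" "\<forall>(c,r)\<in>T. 0 < r" "E k \<subseteq> (\<Union>(c,r)\<in>T. ball c (6 * r))" "(\<Sum>(c,r)\<in>T. r powr a) \<le> c k"
      using cover[of k] by blast
    show ?thesis
      by (rule hausdorff_premeasure_le_balls[OF a T(1) _ T(3,4)]) (use T(2) K0[OF k] \<open>0 < \<delta>\<close> in auto)
  qed
  have tail: "hausdorff_premeasure \<delta> a A \<le> ennreal (12 powr a * (\<Sum>k. c (k + K)))" if K: "K0 \<le> K" for K
  proof -
    have "hausdorff_premeasure \<delta> a A \<le> hausdorff_premeasure \<delta> a (\<Union>k. E (k + K))"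
      by (rule hausdorff_premeasure_mono[OF A])
    also have "\<dots> \<le> (\<Sum>k. hausdorff_premeasure \<delta> a (E (k + K)))" by (rule hausdorff_premeasure_UN_le)
    also have "\<dots> \<le> (\<Sum>k. ennreal (12 powr a * c (k + K)))"
      using K by (intro suminf_le pre summableI) auto
    also have "\<dots> = ennreal (12 powr a * (\<Sum>k. c (k + K)))"
    proof -
      have "summable (\<lambda>k. c (k + K))" using c by (rule summable_ignore_initial_segment)
      then show ?thesis using c0 by (subst suminf_ennreal2) (auto intro!: summable_mult simp: suminf_mult)
    qed
    finally show ?thesis .
  qed
  have "(\<lambda>K. ennreal (12 powr a * (\<Sum>k. c (k + K)))) \<longlonglongrightarrow> ennreal (12 powr a * 0)"
    using suminf_exist_split2[OF c] by (intro tendsto_intros tendsto_ennrealI)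
  then have "hausdorff_premeasure \<delta> a A \<le> ennreal (12 powr a * 0)"
    by (rule Lim_bounded2[of _ _ K0]) (use tail in auto)
  then show "hausdorff_premeasure \<delta> a A = 0" by simp
qed

subsection \<open>Maximal weights and almost orthogonality\<close>

text \<open>Greedy construction: points are added one at a time, and a new point receives the
  smallest slack left among the constraints on sets containing it. This keeps all constraints valid
  and makes one of them an equality.\<close>

lemma saturating_weights:
  fixes S :: "'b \<Rightarrow> 'a set" and cap :: "'b \<Rightarrow> real"
  assumes "finite X" "finite B" "\<And>x. x \<in> X \<Longrightarrow> \<exists>b\<in>B. x \<in> S b" "\<And>b. b \<in> B \<Longrightarrow> 0 \<le> cap b"
  shows "\<exists>w. (\<forall>x. 0 \<le> w x) \<and> (\<forall>b\<in>B. sum w (X \<inter> S b) \<le> cap b) \<and>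
             (\<forall>x\<in>X. \<exists>b\<in>B. x \<in> S b \<and> sum w (X \<inter> S b) = cap b)"
  using assms(1,3)
proof (induction X)
  case empty
  then show ?case using assms(4) by (intro exI[of _ "\<lambda>_. 0"]) auto
next
  case (insert x X)
  have "\<exists>w. (\<forall>x. 0 \<le> w x) \<and> (\<forall>b\<in>B. sum w (X \<inter> S b) \<le> cap b) \<and>
             (\<forall>x\<in>X. \<exists>b\<in>B. x \<in> S b \<and> sum w (X \<inter> S b) = cap b)"
    by (rule insert.IH) (use insert.prems in blast)
  then obtain w where w: "\<And>x. 0 \<le> w x" "\<And>b. b \<in> B \<Longrightarrow> sum w (X \<inter> S b) \<le> cap b"
    "\<And>x. x \<in> X \<Longrightarrow> \<exists>b\<in>B. x \<in> S b \<and> sum w (X \<inter> S b) = cap b" by blast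
  define slack where "slack b = cap b - sum w (X \<inter> S b)" for b
  define \<epsilon> where "\<epsilon> = Min (slack ` {b\<in>B. x \<in> S b})"
  have fin: "finite {b\<in>B. x \<in> S b}" and ne: "{b\<in>B. x \<in> S b} \<noteq> {}"
    using assms(2) insert.prems by auto
  have "\<epsilon> \<in> slack ` {b\<in>B. x \<in> S b}"
    unfolding \<epsilon>_def using fin ne by (intro Min_in) auto
  then obtain b0 where b0: "b0 \<in> B" "x \<in> S b0" "\<epsilon> = slack b0" by auto
  have \<epsilon>_le: "\<epsilon> \<le> slack b" if "b \<in> B" "x \<in> S b" for b
    unfolding \<epsilon>_def using fin that by (intro Min_le) auto
  have \<epsilon>_nonneg: "0 \<le> \<epsilon>" using b0 w(2)[of b0] by (simp add: slack_def)
  define v where "v = w(x := \<epsilon>)"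
  have sum_v: "sum v (insert x X \<inter> S b) = sum w (X \<inter> S b) + (if x \<in> S b then \<epsilon> else 0)" for b
  proof -
    have "sum v (X \<inter> S b) = sum w (X \<inter> S b)"
      using insert.hyps by (intro sum.cong) (auto simp: v_def)
    moreover have "x \<notin> X \<inter> S b" "finite (X \<inter> S b)" using insert.hyps by auto
    ultimately show ?thesis by (auto simp: Int_insert_left v_def)
  qed
  have feasible: "sum v (insert x X \<inter> S b) \<le> cap b" if "b \<in> B" for b
    using \<epsilon>_le[OF that] w(2)[OF that] by (auto simp: sum_v slack_def)
  show ?case
  proof (intro exI[of _ v] conjI ballI allI)
    show "0 \<le> v y" for y using w(1) \<epsilon>_nonneg by (simp add: v_def)
    show "sum v (insert x X \<inter> S b) \<le> cap b" if "b \<in> B" for b by (rule feasible[OF that])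
    fix y assume "y \<in> insert x X"
    then consider "y = x" | "y \<in> X" by blast
    then show "\<exists>b\<in>B. y \<in> S b \<and> sum v (insert x X \<inter> S b) = cap b"
    proof cases
      case 1
      have "sum v (insert x X \<inter> S b0) = cap b0"
        unfolding sum_v using b0 by (simp add: slack_def)
      then show ?thesis using 1 b0 by blast
    next
      case 2
      then obtain b where b: "b \<in> B" "y \<in> S b" "sum w (X \<inter> S b) = cap b" using w(3) by blast
      \<comment> \<open>An equality reached earlier persists: if \<open>S b\<close> also contains
        \<open>x\<close>, feasibility leaves no room above \<open>cap b\<close>, so the increment
        \<open>\<epsilon>\<close> must be 0.\<close>
      then have "sum v (insert x X \<inter> S b) = cap b"
        using feasible[OF b(1)] \<epsilon>_nonneg by (auto simp: sum_v split: if_splits)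
      then show ?thesis using b by blast
    qed
  qed
qed

text \<open>A finite Frostman lemma with a converse built in: the weights obey the ball condition at
  the radii in \<open>Q\<close>, and their total mass still dominates the cost of a cover. Each
  saturated ball has mass exactly \<open>r powr a\<close>, so a disjoint Vitali subfamily costs at
  most the total mass; its fivefold enlargements cover \<open>X\<close>.\<close>

lemma discrete_frostman:
  fixes X :: "'a::euclidean_space set" and a :: real
  assumes X: "finite X" and Q: "finite Q" "Q \<noteq> {}" "\<And>r. r \<in> Q \<Longrightarrow> 0 < r"
  obtains w T where "\<And>x. 0 \<le> w x" "\<And>x r. x \<in> X \<Longrightarrow> r \<in> Q \<Longrightarrow> sum w (X \<inter> ball x r) \<le> r powr a"
    "T \<subseteq> X \<times> Q" "finite T" "X \<subseteq> (\<Union>(c,r)\<in>T. ball c (5 * r))" "(\<Sum>(c,r)\<in>T. r powr a) \<le> sum w X"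
proof -
  let ?S = "\<lambda>b::'a \<times> real. ball (fst b) (snd b)"
  have "\<exists>w. (\<forall>x. 0 \<le> w x) \<and> (\<forall>b\<in>X \<times> Q. sum w (X \<inter> ?S b) \<le> snd b powr a) \<and>
      (\<forall>x\<in>X. \<exists>b\<in>X \<times> Q. x \<in> ?S b \<and> sum w (X \<inter> ?S b) = snd b powr a)"
    by (rule saturating_weights) (use X Q in fastforce)+
  then obtain w where w: "\<And>x. 0 \<le> w x"
    "\<And>b. b \<in> X \<times> Q \<Longrightarrow> sum w (X \<inter> ?S b) \<le> snd b powr a"
    "\<And>x. x \<in> X \<Longrightarrow> \<exists>b\<in>X \<times> Q. x \<in> ?S b \<and> sum w (X \<inter> ?S b) = snd b powr a"
    by blast
  define K where "K = {b\<in>X \<times> Q. sum w (X \<inter> ball (fst b) (snd b)) = snd b powr a}"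
  have "finite K" using X Q by (simp add: K_def)
  have "0 < snd b \<and> snd b \<le> Max Q" if "b \<in> K" for b
    using that Q by (auto simp: K_def)
  then obtain T where T: "T \<subseteq> K" "pairwise (\<lambda>i j. disjnt (?S i) (?S j)) T"
      "(\<Union>b\<in>K. ?S b) \<subseteq> (\<Union>b\<in>T. ball (fst b) (5 * snd b))"
    by (rule Vitali_covering_lemma_balls[where S = "\<Union>b\<in>K. ?S b" and K = K and a = fst and r = snd and B = "Max Q", rotated])
       auto
  have finT: "finite T" using T(1) \<open>finite K\<close> finite_subset by blast
  have "(\<Sum>b\<in>T. snd b powr a) = (\<Sum>b\<in>T. sum w (X \<inter> ball (fst b) (snd b)))"
    using T(1) by (intro sum.cong) (auto simp: K_def)
  also have "\<dots> = sum w (\<Union>b\<in>T. X \<inter> ball (fst b) (snd b))"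
  proof (rule sum.UNION_disjoint[symmetric])
    have "?S b \<inter> ?S b' = {}" if "b \<in> T" "b' \<in> T" "b \<noteq> b'" for b b'
      using T(2) that unfolding pairwise_def disjnt_def by blast
    then show "\<forall>b\<in>T. \<forall>b'\<in>T. b \<noteq> b' \<longrightarrow> X \<inter> ?S b \<inter> (X \<inter> ?S b') = {}" by blast
  qed (use finT X in auto)
  also have "\<dots> \<le> sum w X" using X w(1) by (intro sum_mono2) auto
  finally have le: "(\<Sum>b\<in>T. snd b powr a) \<le> sum w X" .
  show ?thesis
  proof
    show "T \<subseteq> X \<times> Q" using T(1) by (auto simp: K_def)
    have "x \<in> (\<Union>b\<in>K. ?S b)" if "x \<in> X" for x
      using w(3)[OF that] unfolding K_def by blast
    then have "X \<subseteq> (\<Union>b\<in>T. ball (fst b) (5 * snd b))" using T(3) by blast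
    then show "X \<subseteq> (\<Union>(c,r)\<in>T. ball c (5 * r))" by (simp add: case_prod_beta)
    show "(\<Sum>(c,r)\<in>T. r powr a) \<le> sum w X" using le by (simp add: case_prod_beta)
    show "sum w (X \<inter> ball x r) \<le> r powr a" if "x \<in> X" "r \<in> Q" for x r
      using w(2)[of "(x,r)"] that by simp
  qed (use w(1) finT in auto)
qed

text \<open>Duality. Pairing \<open>g\<close> with the weighted sum \<open>h\<close> of the
  \<open>e x\<close>, with phases chosen so that nothing cancels, gives at least
  \<open>\<kappa> * W\<close>. Expanding the square of \<open>h\<close> and applying the row sum
  bound gives at most \<open>W * B\<close>. By Cauchy-Schwarz
  \<open>\<kappa>^2 * W^2 \<le> A * W * B\<close>.\<close>

lemma almost_orthogonality:
  fixes e :: "'i \<Rightarrow> 'a \<Rightarrow> complex" and g :: "'a \<Rightarrow> complex" and w :: "'i \<Rightarrow> real"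
  assumes X: "finite X" and w: "\<And>x. x \<in> X \<Longrightarrow> 0 \<le> w x" and "0 < \<kappa>" "0 < B"
    and g2: "integrable M (\<lambda>\<xi>. (norm (g \<xi>))\<^sup>2)" "(LINT \<xi>|M. (norm (g \<xi>))\<^sup>2) \<le> A"
    and eg: "\<And>x. x \<in> X \<Longrightarrow> integrable M (\<lambda>\<xi>. e x \<xi> * g \<xi>)"
    and ee: "\<And>x y. x \<in> X \<Longrightarrow> y \<in> X \<Longrightarrow> integrable M (\<lambda>\<xi>. e x \<xi> * cnj (e y \<xi>))"
    and large: "\<And>x. x \<in> X \<Longrightarrow> \<kappa> \<le> norm (LINT \<xi>|M. e x \<xi> * g \<xi>)"
    and schur: "\<And>x. x \<in> X \<Longrightarrow> (\<Sum>y\<in>X. w y * norm (LINT \<xi>|M. e x \<xi> * cnj (e y \<xi>))) \<le> B"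
  shows "sum w X \<le> A * B / \<kappa>\<^sup>2"
proof -
  define W where "W = sum w X"
  define c where "c x = cnj (sgn (LINT \<xi>|M. e x \<xi> * g \<xi>))" for x
  define h where "h \<xi> = (\<Sum>x\<in>X. of_real (w x) * c x * e x \<xi>)" for \<xi>
  have c1: "norm (c x) \<le> 1" for x by (simp add: c_def norm_sgn)
  have c2: "c x * (LINT \<xi>|M. e x \<xi> * g \<xi>) = of_real (norm (LINT \<xi>|M. e x \<xi> * g \<xi>))" for x
  proof -
    define z where "z = (LINT \<xi>|M. e x \<xi> * g \<xi>)"
    have "cnj (sgn z) * z = of_real (norm z)"
    proof (cases "z = 0")
      case False
      have "cnj z * z = of_real (norm z) * of_real (norm z)"
        using complex_norm_square[of z] by (simp add: mult.commute power2_eq_square)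
      then show ?thesis using False by (simp add: sgn_eq field_simps)
    qed simp
    then show ?thesis by (simp add: c_def z_def)
  qed
  have hg_int: "integrable M (\<lambda>\<xi>. h \<xi> * g \<xi>)"
    unfolding h_def sum_distrib_right mult.assoc
    by (intro Bochner_Integration.integrable_sum integrable_mult_right eg)
  have "(LINT \<xi>|M. h \<xi> * g \<xi>) = (\<Sum>x\<in>X. of_real (w x) * (c x * (LINT \<xi>|M. e x \<xi> * g \<xi>)))"
    unfolding h_def sum_distrib_right mult.assoc
    by (subst Bochner_Integration.integral_sum) (auto intro!: integrable_mult_right eg)
  also have "\<dots> = of_real (\<Sum>x\<in>X. w x * norm (LINT \<xi>|M. e x \<xi> * g \<xi>))"
    by (simp add: c2)
  finally have hg: "(LINT \<xi>|M. h \<xi> * g \<xi>) = of_real (\<Sum>x\<in>X. w x * norm (LINT \<xi>|M. e x \<xi> * g \<xi>))" .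
  have "\<kappa> * W = (\<Sum>x\<in>X. w x * \<kappa>)" by (simp add: W_def sum_distrib_left mult.commute)
  also have "\<dots> \<le> (\<Sum>x\<in>X. w x * norm (LINT \<xi>|M. e x \<xi> * g \<xi>))"
    by (intro sum_mono mult_left_mono large w)
  also have "\<dots> \<le> norm (LINT \<xi>|M. h \<xi> * g \<xi>)" unfolding hg norm_of_real by simp
  finally have lower: "\<kappa> * W \<le> norm (LINT \<xi>|M. h \<xi> * g \<xi>)" .
  \<comment> \<open>The square is written as a double sum of the products
    \<open>e x * cnj (e y)\<close>, whose integrability is assumed; square integrability of
    \<open>h\<close> follows from this.\<close>
  have hh: "of_real ((norm (h \<xi>))\<^sup>2) =
      (\<Sum>x\<in>X. \<Sum>y\<in>X. (of_real (w x) * c x * of_real (w y) * cnj (c y)) * (e x \<xi> * cnj (e y \<xi>)))" for \<xi>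
    unfolding complex_norm_square h_def cnj_sum sum_product
    by (intro sum.cong) (auto simp: mult_ac)
  have hh_int: "integrable M (\<lambda>\<xi>. complex_of_real ((norm (h \<xi>))\<^sup>2))"
    unfolding hh by (intro Bochner_Integration.integrable_sum integrable_mult_right ee)
  have h_int: "integrable M (\<lambda>\<xi>. (norm (h \<xi>))\<^sup>2)"
    using integrable_Re[OF hh_int] by simp
  have "(LINT \<xi>|M. (norm (h \<xi>))\<^sup>2) = norm (LINT \<xi>|M. complex_of_real ((norm (h \<xi>))\<^sup>2))"
    by (simp only: integral_complex_of_real norm_of_real) (simp add: integral_nonneg_AE)
  also have "\<dots> = norm (\<Sum>x\<in>X. \<Sum>y\<in>X. (of_real (w x) * c x * of_real (w y) * cnj (c y)) * (LINT \<xi>|M. e x \<xi> * cnj (e y \<xi>)))"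
    unfolding hh
    by (subst Bochner_Integration.integral_sum, (intro Bochner_Integration.integrable_sum integrable_mult_right ee; assumption),
        intro arg_cong[where f = norm] sum.cong refl,
        subst Bochner_Integration.integral_sum) (auto intro!: ee)
  also have "\<dots> \<le> (\<Sum>x\<in>X. \<Sum>y\<in>X. w x * (w y * norm (LINT \<xi>|M. e x \<xi> * cnj (e y \<xi>))))"
  proof (intro sum_norm_le)
    fix x y assume xy: "x \<in> X" "y \<in> X"
    let ?z = "LINT \<xi>|M. e x \<xi> * cnj (e y \<xi>)"
    have "norm (of_real (w x) * c x * of_real (w y) * cnj (c y) * ?z)
        = (norm (c x) * norm (c y)) * (w x * w y * norm ?z)"
      using w[OF xy(1)] w[OF xy(2)] by (simp add: norm_mult)
    also have "\<dots> \<le> 1 * (w x * w y * norm ?z)"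
      using w[OF xy(1)] w[OF xy(2)] c1 by (intro mult_right_mono mult_le_one) auto
    finally show "norm (of_real (w x) * c x * of_real (w y) * cnj (c y) * ?z) \<le> w x * (w y * norm ?z)"
      by (simp add: mult.assoc)
  qed
  also have "\<dots> = (\<Sum>x\<in>X. w x * (\<Sum>y\<in>X. w y * norm (LINT \<xi>|M. e x \<xi> * cnj (e y \<xi>))))"
    by (simp add: sum_distrib_left)
  also have "\<dots> \<le> (\<Sum>x\<in>X. w x * B)" by (intro sum_mono mult_left_mono schur w)
  also have "\<dots> = W * B" by (simp add: W_def sum_distrib_right)
  finally have h2: "(LINT \<xi>|M. (norm (h \<xi>))\<^sup>2) \<le> W * B" .
  \<comment> \<open>Cauchy-Schwarz is replaced by \<open>2 * u * v \<le> p * u^2 + v^2 / p\<close>.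
    With this \<open>p\<close> the contribution of \<open>h\<close> is exactly
    \<open>\<kappa> * W / 2\<close>, which is absorbed into the lower bound.\<close>
  define p where "p = B / \<kappa>"
  have p: "0 < p" using assms by (simp add: p_def)
  have "norm (LINT \<xi>|M. h \<xi> * g \<xi>) \<le> (LINT \<xi>|M. p / 2 * (norm (g \<xi>))\<^sup>2 + 1 / (2 * p) * (norm (h \<xi>))\<^sup>2)"
  proof (rule order_trans[OF integral_norm_bound], rule integral_mono)
    show "norm (h \<xi> * g \<xi>) \<le> p / 2 * (norm (g \<xi>))\<^sup>2 + 1 / (2 * p) * (norm (h \<xi>))\<^sup>2" for \<xi>
    proof -
      have "0 \<le> (p * norm (g \<xi>) - norm (h \<xi>))\<^sup>2 / (2 * p)" using p by simp
      also have "\<dots> = p / 2 * (norm (g \<xi>))\<^sup>2 + 1 / (2 * p) * (norm (h \<xi>))\<^sup>2 - norm (h \<xi>) * norm (g \<xi>)"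
        using p by (simp add: field_simps power2_eq_square)
      finally show ?thesis by (simp add: norm_mult)
    qed
  qed (use hg_int g2(1) h_int in auto)
  also have "\<dots> = p / 2 * (LINT \<xi>|M. (norm (g \<xi>))\<^sup>2) + 1 / (2 * p) * (LINT \<xi>|M. (norm (h \<xi>))\<^sup>2)"
    using g2(1) h_int by simp
  also have "\<dots> \<le> p / 2 * A + 1 / (2 * p) * (W * B)"
    using p g2(2) h2 by (intro add_mono mult_left_mono) auto
  also have "1 / (2 * p) * (W * B) = \<kappa> * W / 2" using assms by (simp add: p_def field_simps)
  finally have "\<kappa> * W \<le> p * A" using lower by linarith
  then have "\<kappa> * W * \<kappa> \<le> A * B" using assms by (simp add: p_def field_simps)
  then show ?thesis using assms by (simp add: W_def[symmetric] field_simps power2_eq_square)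
qed

subsection \<open>Oscillatory integrals\<close>

text \<open>Stands in for integration by parts: \<open>F\<close> is an approximate antiderivative of
  \<open>f\<close>, and the error is dominated by the derivative of some \<open>G\<close>, so that
  only boundary values remain.\<close>

lemma norm_integral_le_telescope:
  fixes f F :: "real \<Rightarrow> complex" and G :: "real \<Rightarrow> real"
  assumes "a \<le> b" and f: "f integrable_on {a..b}"
    and F: "\<And>x. x \<in> {a..b} \<Longrightarrow> (F has_vector_derivative F' x) (at x within {a..b})"
    and G: "\<And>x. x \<in> {a..b} \<Longrightarrow> (G has_vector_derivative G' x) (at x within {a..b})"
    and le: "\<And>x. x \<in> {a..b} \<Longrightarrow> norm (f x - F' x) \<le> G' x"
  shows "norm (integral {a..b} f) \<le> norm (F b) + norm (F a) + (G b - G a)"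
proof -
  have iF: "(F' has_integral (F b - F a)) {a..b}" and iG: "(G' has_integral (G b - G a)) {a..b}"
    using fundamental_theorem_of_calculus[OF assms(1)] F G by blast+
  have "norm (integral {a..b} (\<lambda>x. f x - F' x)) \<le> integral {a..b} G'"
    using f iF iG le by (intro integral_norm_bound_integral integrable_diff) (auto simp: has_integral_iff)
  also have "integral {a..b} (\<lambda>x. f x - F' x) = integral {a..b} f - (F b - F a)"
    using f iF by (subst Henstock_Kurzweil_Integration.integral_diff) (auto simp: has_integral_iff)
  finally have "norm (integral {a..b} f - (F b - F a)) \<le> G b - G a"
    using iG by (simp add: has_integral_iff)
  then show ?thesis
    using norm_triangle_ineq4[of "F b" "F a"] norm_triangle_sub[of "integral {a..b} f" "F b - F a"] by linarith
qed

lemma integrable_on_cis: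
  fixes \<phi> \<phi>' :: "real \<Rightarrow> real"
  assumes "\<And>x. x \<in> {a..b} \<Longrightarrow> (\<phi> has_real_derivative \<phi>' x) (at x within {a..b})"
  shows "(\<lambda>x. cis (\<phi> x)) integrable_on {a..b}"
proof (rule integrable_continuous_real)
  have "continuous_on {a..b} \<phi>"
    by (rule DERIV_continuous_on) (use assms in blast)
  then show "continuous_on {a..b} (\<lambda>x. cis (\<phi> x))"
    unfolding cis_conv_exp by (intro continuous_intros)
qed

lemma cis_has_vector_derivative:
  assumes "(\<phi> has_real_derivative d) (at x within S)"
  shows "((\<lambda>x. cis (\<phi> x)) has_vector_derivative (\<i> * of_real d * cis (\<phi> x))) (at x within S)"
  using assms by (auto intro!: derivative_eq_intros simp: has_vector_derivative_def has_field_derivative_def fun_eq_iff scaleR_conv_of_real)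

text \<open>The source of approximate antiderivatives of \<open>cis (\<phi> x)\<close>: the first
  term of the derivative is close to it when \<open>h\<close> is close to
  \<open>1 / \<phi>'\<close>, and the second is an error governed by the derivative of
  \<open>h\<close>.\<close>

lemma cis_mult_has_vector_derivative:
  fixes \<phi> h :: "real \<Rightarrow> real"
  assumes "(\<phi> has_real_derivative d) (at x within S)" "(h has_real_derivative e) (at x within S)"
  shows "((\<lambda>x. - \<i> * cis (\<phi> x) * of_real (h x)) has_vector_derivative
            (of_real (d * h x) * cis (\<phi> x) - \<i> * cis (\<phi> x) * of_real e)) (at x within S)"
proof -
  have h: "((\<lambda>x. complex_of_real (h x)) has_vector_derivative of_real e) (at x within S)"
    using assms(2) by (intro has_vector_derivative_of_real) (simp add: has_real_derivative_iff_has_vector_derivative)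
  have "((\<lambda>x. (- \<i>) * (cis (\<phi> x) * of_real (h x))) has_vector_derivative
            (- \<i>) * (cis (\<phi> x) * of_real e + (\<i> * of_real d * cis (\<phi> x)) * of_real (h x))) (at x within S)"
    by (intro has_vector_derivative_mult_right has_vector_derivative_mult cis_has_vector_derivative assms h)
  then show ?thesis by (simp add: algebra_simps)
qed

text \<open>Here \<open>h = 1 / \<phi>'\<close> and the first term is exact. By convexity of the
  phase the error has norm \<open>\<phi>'' / \<phi>'^2\<close>, which is the derivative of
  \<open>- 1 / \<phi>'\<close>. Four boundary values of size \<open>1 / \<mu>\<close> are
  left.\<close>

lemma van_der_Corput_first:
  fixes \<phi> \<phi>' \<phi>'' :: "real \<Rightarrow> real"
  assumes "a \<le> b" "0 < \<mu>"
    and 1: "\<And>x. x \<in> {a..b} \<Longrightarrow> (\<phi> has_real_derivative \<phi>' x) (at x within {a..b})"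
    and 2: "\<And>x. x \<in> {a..b} \<Longrightarrow> (\<phi>' has_real_derivative \<phi>'' x) (at x within {a..b})"
    and mono: "\<And>x. x \<in> {a..b} \<Longrightarrow> 0 \<le> \<phi>'' x"
    and large: "\<And>x. x \<in> {a..b} \<Longrightarrow> \<mu> \<le> \<bar>\<phi>' x\<bar>"
  shows "norm (integral {a..b} (\<lambda>x. cis (\<phi> x))) \<le> 4 / \<mu>"
proof -
  have nz: "\<phi>' x \<noteq> 0" if "x \<in> {a..b}" for x using large[OF that] assms(2) by auto
  have small: "\<bar>1 / \<phi>' x\<bar> \<le> 1 / \<mu>" if "x \<in> {a..b}" for x
    using large[OF that] assms(2) by (auto simp: field_simps)
  have D: "((\<lambda>x. 1 / \<phi>' x) has_real_derivative (- \<phi>'' x / (\<phi>' x)\<^sup>2)) (at x within {a..b})"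
    if "x \<in> {a..b}" for x
    using 2[OF that] nz[OF that] by (auto intro!: derivative_eq_intros simp: power2_eq_square)
  have "norm (integral {a..b} (\<lambda>x. cis (\<phi> x)))
      \<le> norm (- \<i> * cis (\<phi> b) * of_real (1 / \<phi>' b)) + norm (- \<i> * cis (\<phi> a) * of_real (1 / \<phi>' a))
        + (- (1 / \<phi>' b) - - (1 / \<phi>' a))"
  proof (rule norm_integral_le_telescope[OF \<open>a \<le> b\<close> integrable_on_cis[OF 1]])
    fix x assume x: "x \<in> {a..b}"
    show "((\<lambda>x. - \<i> * cis (\<phi> x) * of_real (1 / \<phi>' x)) has_vector_derivative
        (of_real (\<phi>' x * (1 / \<phi>' x)) * cis (\<phi> x) - \<i> * cis (\<phi> x) * of_real (- \<phi>'' x / (\<phi>' x)\<^sup>2)))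
        (at x within {a..b})"
      by (rule cis_mult_has_vector_derivative[OF 1[OF x] D[OF x]])
    show "((\<lambda>x. - (1 / \<phi>' x)) has_vector_derivative (\<phi>'' x / (\<phi>' x)\<^sup>2)) (at x within {a..b})"
      using DERIV_minus[OF D[OF x]] by (simp add: has_real_derivative_iff_has_vector_derivative)
    show "norm (cis (\<phi> x) - (of_real (\<phi>' x * (1 / \<phi>' x)) * cis (\<phi> x) - \<i> * cis (\<phi> x) * of_real (- \<phi>'' x / (\<phi>' x)\<^sup>2)))
        \<le> \<phi>'' x / (\<phi>' x)\<^sup>2"
      using nz[OF x] mono[OF x] by (simp add: norm_mult norm_divide norm_power)
  qed
  also have "\<dots> = \<bar>1 / \<phi>' b\<bar> + \<bar>1 / \<phi>' a\<bar> + (1 / \<phi>' a - 1 / \<phi>' b)"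
    by (simp add: norm_mult norm_divide)
  also have "\<dots> \<le> 1 / \<mu> + 1 / \<mu> + (1 / \<mu> + 1 / \<mu>)"
    proof -
    have "a \<in> {a..b}" "b \<in> {a..b}" using \<open>a \<le> b\<close> by auto
    from this[THEN small] show ?thesis by linarith
  qed
  finally show ?thesis by simp
qed

text \<open>The test function \<open>h (\<phi>')\<close> with \<open>h u = u / (u\<^sup>2 + \<delta>\<^sup>2)\<close> replaces \<open>1 / \<phi>'\<close>, which avoids
  cutting out a neighbourhood of the stationary point.\<close>

lemma van_der_Corput_second:
  fixes \<phi> \<phi>' \<phi>'' :: "real \<Rightarrow> real"
  assumes "a \<le> b" "0 < \<mu>"
    and 1: "\<And>x. x \<in> {a..b} \<Longrightarrow> (\<phi> has_real_derivative \<phi>' x) (at x within {a..b})"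
    and 2: "\<And>x. x \<in> {a..b} \<Longrightarrow> (\<phi>' has_real_derivative \<phi>'' x) (at x within {a..b})"
    and large: "\<And>x. x \<in> {a..b} \<Longrightarrow> \<mu> \<le> \<phi>'' x"
  shows "norm (integral {a..b} (\<lambda>x. cis (\<phi> x))) \<le> 10 / sqrt \<mu>"
proof -
  define \<delta> where "\<delta> = sqrt \<mu>"
  have \<delta>: "0 < \<delta>" "\<mu> = \<delta>\<^sup>2" using assms(2) by (auto simp: \<delta>_def)
  define h where "h x = \<phi>' x / ((\<phi>' x)\<^sup>2 + \<delta>\<^sup>2)" for x
  \<comment> \<open>The derivative of \<open>G\<close> is
    \<open>2 * \<phi>'' / (\<phi>'^2 + \<delta>^2)\<close>, which dominates both errors below, while
    \<open>G\<close> itself stays bounded by \<open>4 / \<delta>\<close> however large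
    \<open>\<phi>'\<close> becomes.\<close>
  define G where "G x = 2 / \<delta> * arctan (\<phi>' x / \<delta>)" for x
  have pos: "0 < (\<phi>' x)\<^sup>2 + \<delta>\<^sup>2" for x using \<delta> by (simp add: add_nonneg_pos)
  have Dh: "(h has_real_derivative ((\<delta>\<^sup>2 - (\<phi>' x)\<^sup>2) * \<phi>'' x / ((\<phi>' x)\<^sup>2 + \<delta>\<^sup>2)\<^sup>2)) (at x within {a..b})"
    if "x \<in> {a..b}" for x
    unfolding h_def using 2[OF that] pos[of x]
    by (auto intro!: derivative_eq_intros simp: divide_simps power2_eq_square algebra_simps)
  have DG: "(G has_real_derivative (2 * \<phi>'' x / ((\<phi>' x)\<^sup>2 + \<delta>\<^sup>2))) (at x within {a..b})"
    if "x \<in> {a..b}" for x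
  proof -
    have "(G has_real_derivative (2 / \<delta> * (inverse (1 + (\<phi>' x / \<delta>)\<^sup>2) * (\<phi>'' x / \<delta>)))) (at x within {a..b})"
      unfolding G_def using 2[OF that] \<delta> by (auto intro!: derivative_eq_intros)
    also have "2 / \<delta> * (inverse (1 + (\<phi>' x / \<delta>)\<^sup>2) * (\<phi>'' x / \<delta>)) = 2 * \<phi>'' x / ((\<phi>' x)\<^sup>2 + \<delta>\<^sup>2)"
    proof -
      have "1 + (\<phi>' x / \<delta>)\<^sup>2 = ((\<phi>' x)\<^sup>2 + \<delta>\<^sup>2) / \<delta>\<^sup>2" using \<delta> by (simp add: field_simps)
      then show ?thesis using \<delta> by (simp add: power2_eq_square)
    qed
    finally show ?thesis .
  qed
  have hb: "\<bar>h x\<bar> \<le> 1 / \<delta>" for x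
  proof -
    have "0 \<le> (\<bar>\<phi>' x\<bar> - \<delta>)\<^sup>2" by simp
    moreover have "0 \<le> \<delta> * \<bar>\<phi>' x\<bar>" using \<delta> by simp
    ultimately have "\<delta> * \<bar>\<phi>' x\<bar> \<le> (\<phi>' x)\<^sup>2 + \<delta>\<^sup>2"
      by (simp add: power2_diff mult.assoc mult.commute[of "\<bar>\<phi>' x\<bar>"])
    then show ?thesis using \<delta> pos[of x] by (simp add: h_def abs_div field_simps)
  qed
  have Gb: "\<bar>G x\<bar> \<le> 4 / \<delta>" for x
  proof -
    have "\<bar>arctan (\<phi>' x / \<delta>)\<bar> \<le> 2"
      using arctan_lbound[of "\<phi>' x / \<delta>"] arctan_ubound[of "\<phi>' x / \<delta>"] pi_less_4 by (auto simp: abs_le_iff)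
    then show ?thesis using \<delta> by (simp add: G_def abs_mult field_simps)
  qed
  have "norm (integral {a..b} (\<lambda>x. cis (\<phi> x)))
      \<le> norm (- \<i> * cis (\<phi> b) * of_real (h b)) + norm (- \<i> * cis (\<phi> a) * of_real (h a)) + (G b - G a)"
  proof (rule norm_integral_le_telescope[OF \<open>a \<le> b\<close> integrable_on_cis[OF 1]])
    fix x assume x: "x \<in> {a..b}"
    define e where "e = (\<delta>\<^sup>2 - (\<phi>' x)\<^sup>2) * \<phi>'' x / ((\<phi>' x)\<^sup>2 + \<delta>\<^sup>2)\<^sup>2"
    show "((\<lambda>x. - \<i> * cis (\<phi> x) * of_real (h x)) has_vector_derivative
        (of_real (\<phi>' x * h x) * cis (\<phi> x) - \<i> * cis (\<phi> x) * of_real e)) (at x within {a..b})"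
      unfolding e_def by (rule cis_mult_has_vector_derivative[OF 1[OF x] Dh[OF x]])
    show "(G has_vector_derivative (2 * \<phi>'' x / ((\<phi>' x)\<^sup>2 + \<delta>\<^sup>2))) (at x within {a..b})"
      using DG[OF x] by (simp add: has_real_derivative_iff_has_vector_derivative)
    have d: "\<delta>\<^sup>2 \<le> \<phi>'' x" "0 \<le> \<phi>'' x" using large[OF x] \<delta> by (auto intro: order_trans[of 0 "\<delta>\<^sup>2"])
    have nz: "(\<phi>' x)\<^sup>2 + \<delta>\<^sup>2 \<noteq> 0" using pos[of x] by linarith
    have \<phi>'h: "\<phi>' x * h x = (\<phi>' x)\<^sup>2 / ((\<phi>' x)\<^sup>2 + \<delta>\<^sup>2)" by (simp add: h_def power2_eq_square)
    have "1 - \<phi>' x * h x = (((\<phi>' x)\<^sup>2 + \<delta>\<^sup>2) - (\<phi>' x)\<^sup>2) / ((\<phi>' x)\<^sup>2 + \<delta>\<^sup>2)"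
      unfolding diff_divide_distrib divide_self[OF nz] \<phi>'h ..
    \<comment> \<open>The defect of \<open>\<phi>' * h\<close> from 1 is where the lower bound on
      \<open>\<phi>''\<close> enters: \<open>\<delta>^2 = \<mu> \<le> \<phi>''\<close>.\<close>
    then have "1 - \<phi>' x * h x = \<delta>\<^sup>2 / ((\<phi>' x)\<^sup>2 + \<delta>\<^sup>2)" by simp
    then have t1: "\<bar>1 - \<phi>' x * h x\<bar> \<le> \<phi>'' x / ((\<phi>' x)\<^sup>2 + \<delta>\<^sup>2)"
      using d pos[of x] by (simp add: divide_right_mono)
    have "\<bar>e\<bar> = \<bar>\<delta>\<^sup>2 - (\<phi>' x)\<^sup>2\<bar> / ((\<phi>' x)\<^sup>2 + \<delta>\<^sup>2) * (\<phi>'' x / ((\<phi>' x)\<^sup>2 + \<delta>\<^sup>2))"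
      using d by (simp add: e_def abs_mult power2_eq_square)
    also have "\<dots> \<le> 1 * (\<phi>'' x / ((\<phi>' x)\<^sup>2 + \<delta>\<^sup>2))"
      using d pos[of x] by (intro mult_right_mono) (auto simp: divide_le_eq abs_le_iff)
    finally have t2: "\<bar>e\<bar> \<le> \<phi>'' x / ((\<phi>' x)\<^sup>2 + \<delta>\<^sup>2)" by simp
    have "norm (cis (\<phi> x) - (of_real (\<phi>' x * h x) * cis (\<phi> x) - \<i> * cis (\<phi> x) * of_real e))
        = norm (cis (\<phi> x) * of_real (1 - \<phi>' x * h x) + cis (\<phi> x) * (\<i> * of_real e))"
      by (simp add: algebra_simps)
    also have "\<dots> \<le> \<bar>1 - \<phi>' x * h x\<bar> + \<bar>e\<bar>"
      by (rule order_trans[OF norm_triangle_ineq]) (simp add: norm_mult del: of_real_diff of_real_mult)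
    also have "\<dots> \<le> 2 * \<phi>'' x / ((\<phi>' x)\<^sup>2 + \<delta>\<^sup>2)" using t1 t2 by simp
    finally show "norm (cis (\<phi> x) - (of_real (\<phi>' x * h x) * cis (\<phi> x) - \<i> * cis (\<phi> x) * of_real e))
        \<le> 2 * \<phi>'' x / ((\<phi>' x)\<^sup>2 + \<delta>\<^sup>2)" .
  qed
  also have "\<dots> = \<bar>h b\<bar> + \<bar>h a\<bar> + (G b - G a)" by (simp add: norm_mult)
  also have "\<dots> \<le> 1 / \<delta> + 1 / \<delta> + (4 / \<delta> + 4 / \<delta>)"
    using hb[of a] hb[of b] Gb[of a] Gb[of b] by (intro add_mono) auto
  finally show ?thesis by (simp add: \<delta>_def)
qed

section \<open>The kernel of one frequency band\<close>

definition annulus :: "real \<Rightarrow> real \<Rightarrow> real set" where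
  "annulus a b = {\<xi>. a < \<bar>\<xi>\<bar> \<and> \<bar>\<xi>\<bar> \<le> b}"

definition wave :: "real \<Rightarrow> real \<Rightarrow> real \<Rightarrow> real \<Rightarrow> complex" where
  "wave m x t \<xi> = cis (x * \<xi> + t * \<bar>\<xi>\<bar> powr m)"

text \<open>For \<open>\<tau> \<le> 0\<close> and \<open>m < 1\<close> the phase is convex. Either
  \<open>d\<close> dominates the derivative of the other term of the phase, and the first derivative
  test gives \<open>1 / \<bar>d\<bar>\<close>, or \<open>\<bar>d\<bar>\<close> is at most of the
  order \<open>\<bar>\<tau>\<bar> * N powr (m - 1)\<close>, and then \<open>\<phi>''\<close> is at
  least of the order \<open>\<bar>d\<bar> / N\<close>. The second case confines \<open>d\<close>
  because \<open>\<bar>\<tau>\<bar> \<le> 2\<close>.\<close>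

lemma half_kernel_bound_nonpos:
  fixes m N b d \<tau> :: real
  assumes m: "0 < m" "m < 1" and N: "0 < N" "N \<le> b" "b \<le> 2 * N" and \<tau>: "-2 \<le> \<tau>" "\<tau> \<le> 0" and "d \<noteq> 0"
  shows "norm (integral {N..b} (\<lambda>\<xi>. cis (d * \<xi> + \<tau> * \<xi> powr m)))
    \<le> 8 / \<bar>d\<bar> + (if \<bar>d\<bar> < 4 * N powr (m - 1) then 30 / sqrt (1 - m) * sqrt (N / \<bar>d\<bar>) else 0)"
proof -
  define \<phi> where "\<phi> \<xi> = d * \<xi> + \<tau> * \<xi> powr m" for \<xi>
  define \<phi>' where "\<phi>' \<xi> = d + \<tau> * (m * \<xi> powr (m - 1))" for \<xi>
  define \<phi>'' where "\<phi>'' \<xi> = \<tau> * (m * ((m - 1) * \<xi> powr (m - 2)))" for \<xi>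
  have 1: "(\<phi> has_real_derivative \<phi>' \<xi>) (at \<xi> within {N..b})" if "\<xi> \<in> {N..b}" for \<xi>
    unfolding \<phi>_def \<phi>'_def using that N
    by (auto intro!: derivative_eq_intros has_real_derivative_powr[THEN DERIV_subset])
  have 2: "(\<phi>' has_real_derivative \<phi>'' \<xi>) (at \<xi> within {N..b})" if "\<xi> \<in> {N..b}" for \<xi>
  proof -
    have "((\<lambda>\<xi>. \<xi> powr (m - 1)) has_real_derivative (m - 1) * \<xi> powr (m - 1 - 1)) (at \<xi> within {N..b})"
      using that N by (intro has_real_derivative_powr[THEN DERIV_subset]) auto
    then have "((\<lambda>\<xi>. \<xi> powr (m - 1)) has_real_derivative (m - 1) * \<xi> powr (m - 2)) (at \<xi> within {N..b})"
      by simp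
    then have "((\<lambda>\<xi>. d + \<tau> * (m * \<xi> powr (m - 1))) has_real_derivative
        0 + \<tau> * (m * ((m - 1) * \<xi> powr (m - 2)))) (at \<xi> within {N..b})"
      by (intro DERIV_add DERIV_const DERIV_cmult)
    then show ?thesis unfolding \<phi>'_def \<phi>''_def by simp
  qed
  have \<phi>''_eq: "\<phi>'' \<xi> = m * \<bar>\<tau>\<bar> * (1 - m) * \<xi> powr (m - 2)" for \<xi>
    using \<tau> by (simp add: \<phi>''_def algebra_simps)
  have nonneg: "0 \<le> m * \<bar>\<tau>\<bar> * (1 - m)" using m by simp
  show ?thesis
  proof (cases "2 * (m * \<bar>\<tau>\<bar> * N powr (m - 1)) \<le> \<bar>d\<bar>")
    case True
    have "norm (integral {N..b} (\<lambda>\<xi>. cis (\<phi> \<xi>))) \<le> 4 / (\<bar>d\<bar> / 2)"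
    proof (rule van_der_Corput_first[OF _ _ 1 2])
      fix \<xi> assume \<xi>: "\<xi> \<in> {N..b}"
      show "0 \<le> \<phi>'' \<xi>" using nonneg by (simp add: \<phi>''_eq)
      have "\<xi> powr (m - 1) \<le> N powr (m - 1)"
        using \<xi> N m by (intro powr_mono2') auto
      then have "m * \<bar>\<tau>\<bar> * \<xi> powr (m - 1) \<le> m * \<bar>\<tau>\<bar> * N powr (m - 1)"
        using m by (intro mult_left_mono) auto
      moreover have "\<bar>\<tau> * (m * \<xi> powr (m - 1))\<bar> = m * \<bar>\<tau>\<bar> * \<xi> powr (m - 1)"
        using m by (simp add: abs_mult)
      ultimately show "\<bar>d\<bar> / 2 \<le> \<bar>\<phi>' \<xi>\<bar>" using True unfolding \<phi>'_def by linarith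
    qed (use N \<open>d \<noteq> 0\<close> in auto)
    then show ?thesis using m N unfolding \<phi>_def by (auto intro: order_trans)
  next
    case False
    have "m * \<bar>\<tau>\<bar> * N powr (m - 1) \<le> 2 * N powr (m - 1)"
      using m \<tau> mult_mono[of m 1 "\<bar>\<tau>\<bar>" 2] by (intro mult_right_mono) auto
    then have small: "\<bar>d\<bar> < 4 * N powr (m - 1)" using False by linarith
    \<comment> \<open>Failure of the case condition bounds \<open>\<bar>d\<bar>\<close> by
      \<open>2 * m * \<bar>\<tau>\<bar> * N powr (m - 1)\<close>. The 8 combines this 2 with the
      loss \<open>2 powr (m - 2) \<ge> 1/4\<close> between the ends of the band.\<close>
    define \<mu> where "\<mu> = (1 - m) * \<bar>d\<bar> / (8 * N)"
    have "norm (integral {N..b} (\<lambda>\<xi>. cis (\<phi> \<xi>))) \<le> 10 / sqrt \<mu>"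
    proof (rule van_der_Corput_second[OF _ _ 1 2])
      fix \<xi> assume \<xi>: "\<xi> \<in> {N..b}"
      have "(1/4) * (N powr (m - 1) / N) \<le> 2 powr (m - 2) * (N powr (m - 1) / N)"
      proof (rule mult_right_mono)
        have "2 powr (-2) \<le> 2 powr (m - 2)" using m by (intro powr_mono) auto
        then show "1/4 \<le> 2 powr (m - 2)" by (simp add: powr_minus powr_numeral)
      qed (use N in simp)
      also have "\<dots> = (2 * N) powr (m - 2)"
        using N by (simp add: powr_mult powr_diff power2_eq_square powr_numeral)
      also have "\<dots> \<le> \<xi> powr (m - 2)" using \<xi> N m by (intro powr_mono2') auto
      finally have *: "(1/4) * (N powr (m - 1) / N) \<le> \<xi> powr (m - 2)" .
      have "\<mu> \<le> (1 - m) * (2 * (m * \<bar>\<tau>\<bar> * N powr (m - 1))) / (8 * N)"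
        unfolding \<mu>_def using m N False by (intro divide_right_mono mult_left_mono) auto
      also have "\<dots> = m * \<bar>\<tau>\<bar> * (1 - m) * ((1/4) * (N powr (m - 1) / N))" by simp
      also have "\<dots> \<le> \<phi>'' \<xi>" unfolding \<phi>''_eq by (rule mult_left_mono[OF * nonneg])
      finally show "\<mu> \<le> \<phi>'' \<xi>" .
    qed (use N m \<open>d \<noteq> 0\<close> in \<open>auto simp: \<mu>_def\<close>)
    also have "10 / sqrt \<mu> = 10 * sqrt 8 / sqrt (1 - m) * sqrt (N / \<bar>d\<bar>)"
      using N m by (simp add: \<mu>_def real_sqrt_mult real_sqrt_divide)
    also have "\<dots> \<le> 30 / sqrt (1 - m) * sqrt (N / \<bar>d\<bar>)"
    proof (intro mult_right_mono divide_right_mono)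
      have "sqrt 8 \<le> sqrt (3\<^sup>2)" by (rule real_sqrt_le_mono) simp
      then show "10 * sqrt 8 \<le> 30" by simp
    qed (use m N in auto)
    finally show ?thesis using small by (simp add: \<phi>_def add_increasing)
  qed
qed

text \<open>Complex conjugation changes the signs of both \<open>d\<close> and
  \<open>\<tau>\<close>, which reduces positive \<open>\<tau>\<close> to the convex case.\<close>

lemma half_kernel_bound:
  fixes m N b d \<tau> :: real
  assumes m: "0 < m" "m < 1" and N: "0 < N" "N \<le> b" "b \<le> 2 * N" and \<tau>: "\<bar>\<tau>\<bar> \<le> 2" and "d \<noteq> 0"
  shows "norm (integral {N..b} (\<lambda>\<xi>. cis (d * \<xi> + \<tau> * \<xi> powr m)))
    \<le> 8 / \<bar>d\<bar> + (if \<bar>d\<bar> < 4 * N powr (m - 1) then 30 / sqrt (1 - m) * sqrt (N / \<bar>d\<bar>) else 0)"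
proof (cases "\<tau> \<le> 0")
  case True
  then show ?thesis using half_kernel_bound_nonpos[OF m N, of \<tau> d] assms by auto
next
  case False
  have "(\<lambda>\<xi>. cis (d * \<xi> + \<tau> * \<xi> powr m)) = (\<lambda>\<xi>. cnj (cis ((- d) * \<xi> + (- \<tau>) * \<xi> powr m)))"
    by (simp add: cis_cnj algebra_simps)
  then have "integral {N..b} (\<lambda>\<xi>. cis (d * \<xi> + \<tau> * \<xi> powr m))
      = cnj (integral {N..b} (\<lambda>\<xi>. cis ((- d) * \<xi> + (- \<tau>) * \<xi> powr m)))"
    by (simp add: integral_cnj)
  then show ?thesis
    using half_kernel_bound_nonpos[OF m N, of "- \<tau>" "- d"] False assms
    by (simp only: complex_mod_cnj abs_minus_cancel)
qed

lemma wave_measurable [measurable]: "wave m x t \<in> borel_measurable borel"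
proof -
  have "cis \<in> borel_measurable borel"
    by (intro borel_measurable_continuous_onI continuous_on_cis continuous_on_id)
  then show ?thesis unfolding wave_def by measurable
qed

lemma wave_measurable_lebesgue [measurable]: "wave m x t \<in> borel_measurable lebesgue"
  by (intro measurable_completion) simp

lemma norm_wave [simp]: "norm (wave m x t \<xi>) = 1"
  by (simp add: wave_def)

lemma annulus_measurable [measurable]: "annulus a b \<in> sets borel"
proof -
  have "annulus a b = (\<lambda>\<xi>. \<bar>\<xi>\<bar>) -` {a<..b} \<inter> space borel" by (auto simp: annulus_def)
  moreover have "(\<lambda>\<xi>::real. \<bar>\<xi>\<bar>) \<in> borel_measurable borel" by measurable
  ultimately show ?thesis by (metis measurable_sets greaterThanAtMost_borel)
qed

lemma annulus_lmeasurable: "annulus a b \<in> lmeasurable"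
proof (rule fmeasurableI2[OF lmeasurable_cbox])
  show "annulus a b \<subseteq> cbox (-b) b" by (auto simp: annulus_def)
  show "annulus a b \<in> sets lebesgue" using annulus_measurable by simp
qed

lemma annulus_wave_integrable: "set_integrable lebesgue (annulus a b) (wave m x t)"
  unfolding set_integrable_def
proof (rule Bochner_Integration.integrable_bound)
  show "integrable lebesgue (\<lambda>\<xi>. indicator (annulus a b) \<xi> :: real)"
    using annulus_lmeasurable by (simp add: fmeasurable_def)
  show "(\<lambda>\<xi>. indicator (annulus a b) \<xi> *\<^sub>R wave m x t \<xi>) \<in> borel_measurable lebesgue"
    using annulus_measurable by (intro borel_measurable_scaleR borel_measurable_indicator) auto
qed (auto simp: indicator_def)

text \<open>Reflection of the negative frequencies preserves \<open>\<bar>\<xi>\<bar> powr m\<close>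
  and replaces \<open>d\<close> by \<open>- d\<close>.\<close>

lemma annulus_integral_wave:
  assumes "0 < N" "N \<le> b"
  shows "(LINT \<xi>:annulus N b|lebesgue. wave m d \<tau> \<xi>) =
    integral {N..b} (\<lambda>\<xi>. cis (d * \<xi> + \<tau> * \<xi> powr m)) + integral {N..b} (\<lambda>\<xi>. cis (- d * \<xi> + \<tau> * \<xi> powr m))"
proof -
  have un: "annulus N b = {N<..b} \<union> {-b..<-N}" using assms by (auto simp: annulus_def)
  have int: "set_integrable lebesgue {N<..b} (wave m d \<tau>)" "set_integrable lebesgue {-b..<-N} (wave m d \<tau>)"
    by (rule set_integrable_subset[OF annulus_wave_integrable[of N b]]; use un in auto)+
  have "(LINT \<xi>:annulus N b|lebesgue. wave m d \<tau> \<xi>)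
      = (LINT \<xi>:{N<..b}|lebesgue. wave m d \<tau> \<xi>) + (LINT \<xi>:{-b..<-N}|lebesgue. wave m d \<tau> \<xi>)"
    unfolding un using assms int by (intro set_integral_Un) auto
  also have "(LINT \<xi>:{N<..b}|lebesgue. wave m d \<tau> \<xi>) = integral {N<..b} (wave m d \<tau>)"
    by (rule set_lebesgue_integral_eq_integral(2)[OF int(1)])
  also have "\<dots> = integral {N..b} (wave m d \<tau>)"
    by (rule integral_spike_set; rule negligible_subset[of "{N}"]) auto
  also have "\<dots> = integral {N..b} (\<lambda>\<xi>. cis (d * \<xi> + \<tau> * \<xi> powr m))"
    using assms by (intro integral_cong) (auto simp: wave_def)
  also have "(LINT \<xi>:{-b..<-N}|lebesgue. wave m d \<tau> \<xi>) = integral {-b..<-N} (wave m d \<tau>)"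
    by (rule set_lebesgue_integral_eq_integral(2)[OF int(2)])
  also have "\<dots> = integral {-b..-N} (wave m d \<tau>)"
    by (rule integral_spike_set; rule negligible_subset[of "{-N}"]) auto
  also have "\<dots> = integral {-b..-N} (\<lambda>\<xi>. (\<lambda>\<xi>. cis (- d * \<xi> + \<tau> * \<xi> powr m)) (- \<xi>))"
    using assms by (intro integral_cong) (auto simp: wave_def)
  also have "\<dots> = integral {N..b} (\<lambda>\<xi>. cis (- d * \<xi> + \<tau> * \<xi> powr m))"
    by (rule Henstock_Kurzweil_Integration.integral_reflect_real)
  finally show ?thesis .
qed

lemma kernel_bound:
  fixes m N b d \<tau> :: real
  assumes m: "0 < m" "m < 1" and N: "0 < N" "N \<le> b" "b \<le> 2 * N" and \<tau>: "\<bar>\<tau>\<bar> \<le> 2" and "d \<noteq> 0"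
  shows "norm (LINT \<xi>:annulus N b|lebesgue. wave m d \<tau> \<xi>)
    \<le> 16 / \<bar>d\<bar> + (if \<bar>d\<bar> < 4 * N powr (m - 1) then 60 / sqrt (1 - m) * sqrt (N / \<bar>d\<bar>) else 0)"
proof -
  have "norm (LINT \<xi>:annulus N b|lebesgue. wave m d \<tau> \<xi>)
     \<le> norm (integral {N..b} (\<lambda>\<xi>. cis (d * \<xi> + \<tau> * \<xi> powr m)))
      + norm (integral {N..b} (\<lambda>\<xi>. cis (- d * \<xi> + \<tau> * \<xi> powr m)))"
    unfolding annulus_integral_wave[OF N(1,2)] by (rule norm_triangle_ineq)
  then show ?thesis
    using half_kernel_bound[OF m N \<tau>, of d] half_kernel_bound[OF m N \<tau>, of "- d"] \<open>d \<noteq> 0\<close>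
    by (auto split: if_splits)
qed

text \<open>Serves the diagonal and the points too close to it for oscillation to help.\<close>

lemma kernel_bound_trivial:
  assumes "0 < N" "N \<le> b" "b \<le> 2 * N"
  shows "norm (LINT \<xi>:annulus N b|lebesgue. wave m d \<tau> \<xi>) \<le> 2 * N"
proof -
  have *: "norm (integral {N..b} (\<lambda>\<xi>. cis (d * \<xi> + \<tau> * \<xi> powr m))) \<le> N" for d
  proof -
    have "continuous_on {N..b} (\<lambda>\<xi>. cis (d * \<xi> + \<tau> * \<xi> powr m))"
      unfolding cis_conv_exp using assms by (intro continuous_intros) auto
    then have "norm (integral {N..b} (\<lambda>\<xi>. cis (d * \<xi> + \<tau> * \<xi> powr m))) \<le> 1 * (b - N)"
      using assms by (intro integral_bound) auto
    also have "\<dots> \<le> N" using assms by simp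
    finally show ?thesis .
  qed
  show ?thesis unfolding annulus_integral_wave[OF assms(1,2)]
    by (rule order_trans[OF norm_triangle_ineq]) (use *[of d] *[of "- d"] in linarith)
qed

subsection \<open>Covering the level sets of a frequency band\<close>

text \<open>Each \<open>y\<close> is charged to the smallest ball around \<open>x\<close>, of radius
  \<open>(1/2) ^ j\<close> with \<open>j \<le> k\<close>, that contains it. There \<open>K y\<close>
  is at most a number \<open>H j\<close> depending only on the scale. Exchanging the sums leaves
  \<open>H j\<close> times the mass of a ball, which the Frostman condition bounds.\<close>

lemma dyadic_schur_bound:
  fixes X :: "real set" and w :: "real \<Rightarrow> real" and K :: "real \<Rightarrow> real" and N \<rho> C a :: real
  assumes X: "finite X" "\<And>y. y \<in> X \<Longrightarrow> \<bar>x - y\<bar> < 1" and w: "\<And>y. 0 \<le> w y" and "0 < N" "0 \<le> C"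
    and ball: "\<And>j. j \<le> k \<Longrightarrow> sum w (X \<inter> ball x ((1/2) ^ j)) \<le> ((1/2) ^ j) powr a"
    and near: "\<And>y. y \<in> X \<Longrightarrow> K y \<le> 2 * 2 ^ k"
    and far: "\<And>y. y \<in> X \<Longrightarrow> y \<noteq> x \<Longrightarrow>
        K y \<le> 16 / \<bar>x - y\<bar> + (if \<bar>x - y\<bar> < \<rho> then C * sqrt (N / \<bar>x - y\<bar>) else 0)"
  shows "(\<Sum>y\<in>X. w y * K y) \<le>
    (\<Sum>j\<le>k. (32 * 2 ^ j + (if (1/2) ^ (j + 1) < \<rho> then 2 * C * sqrt (N * 2 ^ j) else 0)) * ((1/2) ^ j) powr a)"
proof -
  define H where "H j = 32 * 2 ^ j + (if (1/2) ^ (j + 1) < \<rho> then 2 * C * sqrt (N * 2 ^ j) else 0)" for j :: nat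
  have H0: "0 \<le> H j" for j using assms(4,5) by (simp add: H_def)
  have K_le: "K y \<le> (\<Sum>j\<le>k. if y \<in> ball x ((1/2) ^ j) then H j else 0)" if y: "y \<in> X" for y
  proof -
    define d where "d = \<bar>x - y\<bar>"
    define J where "J = {j. j \<le> k \<and> d < (1/2) ^ j}"
    have J: "finite J" "0 \<in> J" using X(2)[OF y] by (auto simp: J_def d_def)
    define j where "j = Max J"
    have jJ: "j \<in> J" using J unfolding j_def by (intro Max_in) auto
    have "K y \<le> H j"
    proof (cases "j = k")
      case True
      have "K y \<le> 32 * 2 ^ k" using near[OF y] by (rule order_trans) simp
      then show ?thesis using assms(4,5) by (simp add: H_def True add_increasing2)
    next
      case False
      have "j + 1 \<notin> J" using Max_ge[OF J(1), of "j + 1"] unfolding j_def by auto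
      \<comment> \<open>The next smaller ball misses \<open>y\<close>, so
        \<open>\<bar>x - y\<bar>\<close> is known up to a factor 2. This produces the 32 and the 2
        in \<open>H j\<close> and the cut-off condition with \<open>j + 1\<close>.\<close>
      then have d: "(1/2) ^ (j + 1) \<le> d" using False jJ by (auto simp: J_def)
      have d0: "0 < d" by (rule less_le_trans[OF _ d]) simp
      have inv: "1 / d \<le> 2 ^ (j + 1)" using d d0 by (simp add: field_simps)
      have "K y \<le> 16 / d + (if d < \<rho> then C * sqrt (N / d) else 0)"
        using far[OF y] d0 by (auto simp: d_def)
      also have "\<dots> \<le> H j" unfolding H_def
      proof (rule add_mono)
        show "16 / d \<le> 32 * 2 ^ j" using inv by simp
        have "sqrt (N / d) \<le> 2 * sqrt (N * 2 ^ j)"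
        proof -
          have "N / d \<le> N * 2 ^ (j + 1)"
            using mult_left_mono[OF inv, of N] \<open>0 < N\<close> by simp
          also have "\<dots> \<le> 2\<^sup>2 * (N * 2 ^ j)" using \<open>0 < N\<close> by simp
          finally have "sqrt (N / d) \<le> sqrt (2\<^sup>2 * (N * 2 ^ j))" by (rule real_sqrt_le_mono)
          then show ?thesis by (simp add: real_sqrt_mult)
        qed
        then have "C * sqrt (N / d) \<le> 2 * C * sqrt (N * 2 ^ j)"
          using mult_left_mono[of "sqrt (N / d)" "2 * sqrt (N * 2 ^ j)" C] \<open>0 \<le> C\<close> by simp
        then show "(if d < \<rho> then C * sqrt (N / d) else 0)
            \<le> (if (1/2) ^ (j + 1) < \<rho> then 2 * C * sqrt (N * 2 ^ j) else 0)"
          using d \<open>0 \<le> C\<close> \<open>0 < N\<close> by auto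
      qed
      finally show ?thesis .
    qed
    also have "\<dots> = (if y \<in> ball x ((1/2) ^ j) then H j else 0)"
      using jJ by (simp add: J_def d_def dist_real_def)
    also have "\<dots> \<le> (\<Sum>j\<le>k. if y \<in> ball x ((1/2) ^ j) then H j else 0)"
      using jJ H0 by (intro member_le_sum) (auto simp: J_def)
    finally show ?thesis .
  qed
  have "(\<Sum>y\<in>X. w y * K y) \<le> (\<Sum>y\<in>X. w y * (\<Sum>j\<le>k. if y \<in> ball x ((1/2) ^ j) then H j else 0))"
    by (intro sum_mono mult_left_mono K_le w)
  also have "\<dots> = (\<Sum>j\<le>k. \<Sum>y\<in>X. w y * (if y \<in> ball x ((1/2) ^ j) then H j else 0))"
    unfolding sum_distrib_left by (rule sum.swap)
  also have "\<dots> = (\<Sum>j\<le>k. H j * sum w (X \<inter> ball x ((1/2) ^ j)))"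
  proof (rule sum.cong[OF refl])
    fix j
    have "(\<Sum>y\<in>X. w y * (if y \<in> ball x ((1/2) ^ j) then H j else 0))
        = (\<Sum>y\<in>X. if y \<in> ball x ((1/2) ^ j) then H j * w y else 0)"
      by (rule sum.cong) auto
    also have "\<dots> = (\<Sum>y\<in>X \<inter> ball x ((1/2) ^ j). H j * w y)"
      using X(1) by (rule sum.inter_restrict[symmetric])
    finally show "(\<Sum>y\<in>X. w y * (if y \<in> ball x ((1/2) ^ j) then H j else 0)) = H j * sum w (X \<inter> ball x ((1/2) ^ j))"
      by (simp add: sum_distrib_left)
  qed
  also have "\<dots> \<le> (\<Sum>j\<le>k. H j * ((1/2) ^ j) powr a)"
    by (intro sum_mono mult_left_mono ball H0) auto
  finally show ?thesis unfolding H_def .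
qed

text \<open>This is where the two exponents in \<open>\<gamma>\<close> arise. The first summand is
  largest at \<open>j = k\<close>. The exponent of the second, \<open>k/2 + j * (1/2 - a)\<close>,
  is linear in \<open>j\<close>: for \<open>a \<le> 1/2\<close> it is largest at
  \<open>j = k\<close>, giving \<open>1 - a\<close> again; for \<open>a > 1/2\<close> it is largest
  at the smallest \<open>j\<close> that the cut-off admits, about \<open>k * (1 - m)\<close>, giving
  the other exponent.\<close>

lemma dyadic_term_bound:
  fixes a \<gamma> m C :: real
  assumes a: "0 < a" "a < 1" and m: "0 < m" "m < 1" and \<gamma>: "1 - a \<le> \<gamma>" "1/2 - (1 - m) * (a - 1/2) \<le> \<gamma>"
    and "0 \<le> C" "j \<le> k"
  shows "(32 * 2 ^ j + (if (1/2) ^ (j + 1) < 4 * (2 ^ k) powr (m - 1) then 2 * C * sqrt (2 ^ k * 2 ^ j) else 0))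
       * ((1/2) ^ j) powr a \<le> (32 + 16 * C) * 2 powr (real k * \<gamma>)"
proof -
  have half: "((1/2::real) ^ j) powr a = 2 powr (- (real j * a))"
  proof -
    have "(1/2::real) ^ j = 2 powr (- real j)"
      by (simp add: powr_minus powr_realpow power_one_over inverse_eq_divide)
    then show ?thesis by (simp add: powr_powr)
  qed
  have t1: "2 ^ j * ((1/2::real) ^ j) powr a \<le> 2 powr (real k * \<gamma>)"
  proof -
    have "2 ^ j * ((1/2::real) ^ j) powr a = 2 powr (real j * (1 - a))"
      unfolding half by (simp add: powr_realpow[symmetric] powr_add[symmetric] algebra_simps)
    also have "\<dots> \<le> 2 powr (real k * \<gamma>)"
      using a \<gamma>(1) \<open>j \<le> k\<close> by (intro powr_mono mult_mono) auto
    finally show ?thesis .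
  qed
  have t2: "sqrt (2 ^ k * 2 ^ j) * ((1/2::real) ^ j) powr a \<le> 8 * 2 powr (real k * \<gamma>)"
    if c: "(1/2) ^ (j + 1) < 4 * (2 ^ k) powr (m - 1)"
  proof -
    have "sqrt (2 ^ k * 2 ^ j) = 2 powr ((real k + real j) / 2)"
    proof -
      have "(2::real) ^ k * 2 ^ j = 2 powr (real k + real j)" by (simp add: powr_add powr_realpow)
      then show ?thesis by (simp add: powr_half_sqrt[symmetric] powr_powr)
    qed
    then have eq: "sqrt (2 ^ k * 2 ^ j) * ((1/2::real) ^ j) powr a = 2 powr (real k / 2 + real j * (1/2 - a))"
      unfolding half by (simp add: powr_add[symmetric] algebra_simps add_divide_distrib)
    show ?thesis
    proof (cases "a \<le> 1/2")
      case True
      have "real j * (1/2 - a) \<le> real k * (1/2 - a)" using True \<open>j \<le> k\<close> by (intro mult_right_mono) auto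
      moreover have "real k * (1 - a) \<le> real k * \<gamma>" using \<gamma>(1) by (intro mult_left_mono) auto
      ultimately have "real k / 2 + real j * (1/2 - a) \<le> real k * \<gamma>" by (simp add: algebra_simps)
      then have "2 powr (real k / 2 + real j * (1/2 - a)) \<le> 1 * 2 powr (real k * \<gamma>)" by simp
      also have "\<dots> \<le> 8 * 2 powr (real k * \<gamma>)" by (intro mult_right_mono) auto
      finally show ?thesis unfolding eq .
    next
      case False
      have "2 powr (- real j - 1) < (2::real) powr (2 + real k * (m - 1))"
      proof -
        have "(1/2::real) ^ (j + 1) = 2 powr (- real j - 1)"
          by (simp add: powr_diff powr_minus powr_realpow power_one_over inverse_eq_divide)
        moreover have "4 * ((2::real) ^ k) powr (m - 1) = 2 powr (2 + real k * (m - 1))"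
          by (simp add: powr_add powr_realpow[symmetric] powr_powr)
        ultimately show ?thesis using c by simp
      qed
      \<comment> \<open>The constants in the cut-off cost the additive 3, which becomes the factor
        \<open>8 = 2 ^ 3\<close>.\<close>
      then have "- real j \<le> 3 - real k * (1 - m)" by (simp add: algebra_simps)
      then have "- real j * (a - 1/2) \<le> (3 - real k * (1 - m)) * (a - 1/2)"
        using False by (intro mult_right_mono) auto
      also have "\<dots> = 3 * (a - 1/2) + real k * (- (1 - m) * (a - 1/2))" by (simp add: field_simps)
      also have "\<dots> \<le> 3 + real k * (\<gamma> - 1/2)"
      proof (intro add_mono mult_left_mono)
        show "- (1 - m) * (a - 1/2) \<le> \<gamma> - 1/2" using \<gamma>(2) by (simp only: mult_minus_left)
      qed (use a in auto)
      finally have "real k / 2 + real j * (1/2 - a) \<le> 3 + real k * \<gamma>" by (simp add: algebra_simps)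
      then have "2 powr (real k / 2 + real j * (1/2 - a)) \<le> 2 powr (3 + real k * \<gamma>)" by simp
      also have "\<dots> = 8 * 2 powr (real k * \<gamma>)" by (simp add: powr_add powr_numeral)
      finally show ?thesis unfolding eq .
    qed
  qed
  have "32 * (2 ^ j * ((1/2::real) ^ j) powr a)
      + (if (1/2) ^ (j + 1) < 4 * (2 ^ k) powr (m - 1) then 2 * C * (sqrt (2 ^ k * 2 ^ j) * ((1/2::real) ^ j) powr a) else 0)
     \<le> 32 * 2 powr (real k * \<gamma>) + 2 * C * (8 * 2 powr (real k * \<gamma>))"
    using t1 mult_left_mono[OF t2, of "2 * C"] \<open>0 \<le> C\<close> by (intro add_mono) auto
  then show ?thesis by (simp add: algebra_simps split: if_splits)
qed

lemma finite_net:
  fixes E :: "'a::heine_borel set"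
  assumes "bounded E" "0 < \<epsilon>"
  obtains X where "finite X" "X \<subseteq> E" "E \<subseteq> (\<Union>x\<in>X. ball x \<epsilon>)"
proof -
  have "compact (closure E)" using assms(1) by simp
  moreover have "closure E \<subseteq> (\<Union>x\<in>E. ball x \<epsilon>)"
    using assms(2) by (auto simp: closure_approachable dist_commute)
  ultimately obtain X where "X \<subseteq> E" "finite X" "closure E \<subseteq> (\<Union>x\<in>X. ball x \<epsilon>)"
    using compactE_image[of "closure E" E "\<lambda>x. ball x \<epsilon>"] by (metis open_ball)
  then show ?thesis using that closure_subset[of E] by blast
qed

lemma annulus_Int: "annulus a b \<inter> annulus a c = annulus a (min b c)"
  by (auto simp: annulus_def)

lemma wave_mult_cnj: "wave m x t \<xi> * cnj (wave m y u \<xi>) = wave m (x - y) (t - u) \<xi>"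
  by (simp add: wave_def cis_cnj cis_mult algebra_simps)

lemma wave_mult_integrable:
  fixes g :: "real \<Rightarrow> complex"
  assumes g: "g \<in> borel_measurable lebesgue" "integrable lebesgue (\<lambda>\<xi>. (norm (g \<xi>))\<^sup>2)"
  shows "set_integrable lebesgue (annulus a b) (\<lambda>\<xi>. wave m x t \<xi> * g \<xi>)"
  unfolding set_integrable_def
proof (rule Bochner_Integration.integrable_bound)
  have "integrable lebesgue (\<lambda>\<xi>. indicator (annulus a b) \<xi> :: real)"
    using annulus_lmeasurable by (simp add: fmeasurable_def)
  then show "integrable lebesgue (\<lambda>\<xi>. indicator (annulus a b) \<xi> + (norm (g \<xi>))\<^sup>2 :: real)"
    using g(2) by simp
  show "(\<lambda>\<xi>. indicator (annulus a b) \<xi> *\<^sub>R (wave m x t \<xi> * g \<xi>)) \<in> borel_measurable lebesgue"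
    using annulus_measurable g(1) by (intro borel_measurable_scaleR borel_measurable_indicator borel_measurable_times) auto
  have "norm (g \<xi>) \<le> 1 + (norm (g \<xi>))\<^sup>2" for \<xi>
    using zero_le_power2[of "norm (g \<xi>) - 1"] norm_ge_zero[of "g \<xi>"] unfolding power2_diff by (simp only: mult_1_right power_one)
  then show "AE \<xi> in lebesgue. norm (indicator (annulus a b) \<xi> *\<^sub>R (wave m x t \<xi> * g \<xi>))
      \<le> norm (indicator (annulus a b) \<xi> + (norm (g \<xi>))\<^sup>2 :: real)"
    by (intro AE_I2) (simp add: indicator_def norm_mult)
qed

text \<open>This is \<open>32 + 16 * C\<close> with \<open>C = 60 / sqrt (1 - m)\<close> the
  constant of the square root term in the kernel bound.\<close>

definition schur_const :: "real \<Rightarrow> real" where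
  "schur_const m = 32 + 960 / sqrt (1 - m)"

lemma level_set_cover:
  fixes g :: "real \<Rightarrow> complex" and a m A \<kappa> \<gamma> :: real
  assumes a: "0 < a" "a < 1" and m: "0 < m" "m < 1" and "0 < \<kappa>"
    and \<gamma>: "1 - a \<le> \<gamma>" "1/2 - (1 - m) * (a - 1/2) \<le> \<gamma>"
    and g: "g \<in> borel_measurable lebesgue" "integrable lebesgue (\<lambda>\<xi>. (norm (g \<xi>))\<^sup>2)"
      "(LINT \<xi>|lebesgue. (norm (g \<xi>))\<^sup>2) \<le> A"
    and E: "\<And>x y. x \<in> E \<Longrightarrow> y \<in> E \<Longrightarrow> \<bar>x - y\<bar> < 1"
    and large: "\<And>x. x \<in> E \<Longrightarrow> \<exists>t R. \<bar>t\<bar> \<le> 1 \<and> 2 ^ k \<le> R \<and> R \<le> 2 * 2 ^ k \<and>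
        \<kappa> \<le> norm (LINT \<xi>:annulus (2 ^ k) R|lebesgue. wave m x t \<xi> * g \<xi>)"
  obtains T where "finite T" "\<And>c r. (c, r) \<in> T \<Longrightarrow> 0 < r" "E \<subseteq> (\<Union>(c,r)\<in>T. ball c (6 * r))"
    "(\<Sum>(c,r)\<in>T. r powr a) \<le> A * (schur_const m * real (k + 1) * 2 powr (real k * \<gamma>)) / \<kappa>\<^sup>2"
proof -
  define N :: real where "N = 2 ^ k"
  have N: "0 < N" by (simp add: N_def)
  have "E \<subseteq> cball x 1" if "x \<in> E" for x
    using E[OF that] by (force simp: dist_real_def)
  then have "bounded E" by (metis bounded_cball bounded_empty bounded_subset ex_in_conv)
  \<comment> \<open>The mesh equals the smallest radius in \<open>Q\<close> below, so a cover of the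
    net becomes a cover of \<open>E\<close> once the radii \<open>5 * r\<close> are raised to
    \<open>6 * r\<close>.\<close>
  then obtain X where X: "finite X" "X \<subseteq> E" "E \<subseteq> (\<Union>x\<in>X. ball x ((1/2) ^ k))"
    by (rule finite_net[of _ "(1/2) ^ k"]) auto
  define Q where "Q = (\<lambda>j. (1/2::real) ^ j) ` {..k}"
  have Q: "finite Q" "Q \<noteq> {}" "\<And>r. r \<in> Q \<Longrightarrow> 0 < r" by (auto simp: Q_def)
  obtain w T where w: "\<And>x. 0 \<le> w x" "\<And>x r. x \<in> X \<Longrightarrow> r \<in> Q \<Longrightarrow> sum w (X \<inter> ball x r) \<le> r powr a"
    and T: "T \<subseteq> X \<times> Q" "finite T" "X \<subseteq> (\<Union>(c,r)\<in>T. ball c (5 * r))" "(\<Sum>(c,r)\<in>T. r powr a) \<le> sum w X"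
    using discrete_frostman[OF X(1) Q] by metis
  have "\<forall>x\<in>X. \<exists>t R. \<bar>t\<bar> \<le> 1 \<and> N \<le> R \<and> R \<le> 2 * N \<and>
        \<kappa> \<le> norm (LINT \<xi>:annulus N R|lebesgue. wave m x t \<xi> * g \<xi>)"
    using large X(2) by (auto simp: N_def)
  \<comment> \<open>The supremum over times and truncations is linearised: each point of the net
    keeps its own pair, and these enter the functions \<open>e x\<close>.\<close>
  then obtain t R where tR: "\<And>x. x \<in> X \<Longrightarrow> \<bar>t x\<bar> \<le> 1" "\<And>x. x \<in> X \<Longrightarrow> N \<le> R x" "\<And>x. x \<in> X \<Longrightarrow> R x \<le> 2 * N"
    "\<And>x. x \<in> X \<Longrightarrow> \<kappa> \<le> norm (LINT \<xi>:annulus N (R x)|lebesgue. wave m x (t x) \<xi> * g \<xi>)"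
    by metis
  define e where "e x \<xi> = indicator (annulus N (R x)) \<xi> *\<^sub>R wave m x (t x) \<xi>" for x \<xi>
  define C where "C = 60 / sqrt (1 - m)"
  have "0 \<le> C" using m by (simp add: C_def)
  define B where "B = schur_const m * real (k + 1) * 2 powr (real k * \<gamma>)"
  have "0 < schur_const m" using m by (auto simp: schur_const_def intro!: add_pos_nonneg)
  then have "0 < B" by (simp add: B_def)
  have eg: "e x \<xi> * g \<xi> = indicator (annulus N (R x)) \<xi> *\<^sub>R (wave m x (t x) \<xi> * g \<xi>)" for x \<xi>
    by (simp add: e_def)
  \<comment> \<open>The product of two truncated waves is again a wave on an annulus with outer
    radius between \<open>N\<close> and \<open>2 * N\<close>, so the kernel bounds apply, with time
    difference at most 2.\<close>
  have ee: "e x \<xi> * cnj (e y \<xi>) =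
      indicator (annulus N (min (R x) (R y))) \<xi> *\<^sub>R wave m (x - y) (t x - t y) \<xi>" for x y \<xi>
    by (simp add: e_def wave_mult_cnj[symmetric] annulus_Int[symmetric] indicator_inter_arith scaleR_conv_of_real)
  have ee_int: "(LINT \<xi>|lebesgue. e x \<xi> * cnj (e y \<xi>)) =
      (LINT \<xi>:annulus N (min (R x) (R y))|lebesgue. wave m (x - y) (t x - t y) \<xi>)" for x y
    unfolding ee set_lebesgue_integral_def ..
  have "sum w X \<le> A * B / \<kappa>\<^sup>2"
  proof (rule almost_orthogonality[OF X(1) w(1) \<open>0 < \<kappa>\<close> \<open>0 < B\<close> g(2,3)])
    fix x assume x: "x \<in> X"
    show "integrable lebesgue (\<lambda>\<xi>. e x \<xi> * g \<xi>)"
      unfolding eg using wave_mult_integrable[OF g(1,2)] by (simp add: set_integrable_def)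
    show "\<kappa> \<le> norm (LINT \<xi>|lebesgue. e x \<xi> * g \<xi>)"
      unfolding eg using tR(4)[OF x] by (simp add: set_lebesgue_integral_def)
    show "integrable lebesgue (\<lambda>\<xi>. e x \<xi> * cnj (e y \<xi>))" for y
      unfolding ee using annulus_wave_integrable by (simp add: set_integrable_def)
    have "(\<Sum>y\<in>X. w y * norm (LINT \<xi>|lebesgue. e x \<xi> * cnj (e y \<xi>))) \<le>
       (\<Sum>j\<le>k. (32 * 2 ^ j + (if (1/2) ^ (j + 1) < 4 * N powr (m - 1) then 2 * C * sqrt (N * 2 ^ j) else 0)) * ((1/2) ^ j) powr a)"
    proof (rule dyadic_schur_bound[OF X(1) _ w(1) N \<open>0 \<le> C\<close>])
      fix y assume y: "y \<in> X"
      have R: "N \<le> min (R x) (R y)" "min (R x) (R y) \<le> 2 * N" using tR(2,3)[OF x] tR(2,3)[OF y] by auto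
      have t: "\<bar>t x - t y\<bar> \<le> 2" using tR(1)[OF x] tR(1)[OF y] by linarith
      show "\<bar>x - y\<bar> < 1" using E x y X(2) by blast
      show "norm (LINT \<xi>|lebesgue. e x \<xi> * cnj (e y \<xi>)) \<le> 2 * 2 ^ k"
        unfolding ee_int using kernel_bound_trivial[OF N R] by (simp add: N_def)
      show "norm (LINT \<xi>|lebesgue. e x \<xi> * cnj (e y \<xi>)) \<le>
         16 / \<bar>x - y\<bar> + (if \<bar>x - y\<bar> < 4 * N powr (m - 1) then C * sqrt (N / \<bar>x - y\<bar>) else 0)" if "y \<noteq> x"
        unfolding ee_int C_def using that by (intro kernel_bound[OF m N R t]) auto
    qed (use w(2)[OF x] in \<open>auto simp: Q_def\<close>)
    \<comment> \<open>All \<open>k + 1\<close> scales obey the same bound, whence the factor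
      \<open>real (k + 1)\<close>.\<close>
    also have "\<dots> \<le> (\<Sum>j\<le>k. (32 + 16 * C) * 2 powr (real k * \<gamma>))"
      unfolding N_def by (intro sum_mono dyadic_term_bound[OF a m \<gamma> \<open>0 \<le> C\<close>]) auto
    also have "\<dots> = B" by (simp add: B_def schur_const_def C_def)
    finally show "(\<Sum>y\<in>X. w y * norm (LINT \<xi>|lebesgue. e x \<xi> * cnj (e y \<xi>))) \<le> B" .
  qed
  then have "(\<Sum>(c,r)\<in>T. r powr a) \<le> A * B / \<kappa>\<^sup>2" using T(4) by linarith
  moreover have "E \<subseteq> (\<Union>(c,r)\<in>T. ball c (6 * r))"
  proof
    fix z assume "z \<in> E"
    then obtain x where x: "x \<in> X" "dist x z < (1/2) ^ k" using X(3) by auto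
    obtain c r where cr: "(c, r) \<in> T" "dist c x < 5 * r" using x(1) T(3) by fastforce
    have "r \<in> Q" using cr(1) T(1) by auto
    then have "(1/2) ^ k \<le> r" by (auto simp: Q_def intro!: power_decreasing)
    then have "dist c z < 6 * r" using x(2) cr(2) dist_triangle[of c z x] by linarith
    then show "z \<in> (\<Union>(c,r)\<in>T. ball c (6 * r))" using cr(1) by (intro UN_I[of "(c,r)"]) auto
  qed
  ultimately show ?thesis using that[of T] T Q(3) unfolding B_def by blast
qed

subsection \<open>Convergence\<close>

text \<open>With inner radius \<open>- 1\<close> the lower condition is vacuous. As annuli are open
  inside and closed outside, a ball and the bands beyond it split disjointly by the next
  lemma.\<close>

lemma cball_eq_annulus: "cball 0 R = annulus (- 1) R"
  by (auto simp: annulus_def)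

lemma annulus_integral_split:
  fixes f :: "real \<Rightarrow> complex"
  assumes "a \<le> b" "b \<le> c" and f: "set_integrable lebesgue (annulus a c) f"
  shows "(LINT \<xi>:annulus a c|lebesgue. f \<xi>) = (LINT \<xi>:annulus a b|lebesgue. f \<xi>) + (LINT \<xi>:annulus b c|lebesgue. f \<xi>)"
proof -
  have un: "annulus a c = annulus a b \<union> annulus b c" using assms by (auto simp: annulus_def)
  show ?thesis
    unfolding un
  proof (rule set_integral_Un)
    show "annulus a b \<inter> annulus b c = {}" by (auto simp: annulus_def)
  qed (rule set_integrable_subset[OF f]; use annulus_measurable un in auto)+
qed

lemma annulus_integral_wave_continuous:
  fixes g :: "real \<Rightarrow> complex"
  assumes g: "g \<in> borel_measurable lebesgue" "integrable lebesgue (\<lambda>\<xi>. (norm (g \<xi>))\<^sup>2)"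
  shows "continuous_on S (\<lambda>t. LINT \<xi>:annulus a b|lebesgue. wave m x t \<xi> * g \<xi>)"
  unfolding continuous_on_sequentially
proof (intro allI ballI impI)
  fix T and t assume "t \<in> S" and "(\<forall>n. T n \<in> S) \<and> T \<longlonglongrightarrow> t"
  then have T: "T \<longlonglongrightarrow> t" by blast
  have int: "integrable lebesgue (\<lambda>\<xi>. indicator (annulus a b) \<xi> *\<^sub>R (wave m x t \<xi> * g \<xi>))" for t
    using wave_mult_integrable[OF g] by (simp add: set_integrable_def)
  show "((\<lambda>t. LINT \<xi>:annulus a b|lebesgue. wave m x t \<xi> * g \<xi>) \<circ> T)
      \<longlonglongrightarrow> (LINT \<xi>:annulus a b|lebesgue. wave m x t \<xi> * g \<xi>)"
    unfolding comp_def set_lebesgue_integral_def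
  proof (rule integral_dominated_convergence)
    \<comment> \<open>Waves have modulus 1, so the integrand at time 0 dominates those at all
      times.\<close>
    show "integrable lebesgue (\<lambda>\<xi>. norm (indicator (annulus a b) \<xi> *\<^sub>R (wave m x 0 \<xi> * g \<xi>)))"
      by (intro integrable_norm int)
    have "(\<lambda>n. wave m x (T n) \<xi>) \<longlonglongrightarrow> wave m x t \<xi>" for \<xi>
      unfolding wave_def cis_conv_exp by (intro tendsto_intros T)
    then show "AE \<xi> in lebesgue. (\<lambda>n. indicator (annulus a b) \<xi> *\<^sub>R (wave m x (T n) \<xi> * g \<xi>))
        \<longlonglongrightarrow> indicator (annulus a b) \<xi> *\<^sub>R (wave m x t \<xi> * g \<xi>)"
      by (intro AE_I2 tendsto_intros)
  qed (use int in \<open>auto simp: norm_mult dest: borel_measurable_integrable\<close>)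
qed

text \<open>The path from \<open>2 ^ K\<close> to \<open>R\<close> runs through the powers of 2,
  with one incomplete band at the end.\<close>

lemma dyadic_telescope_bound:
  fixes S :: "real \<Rightarrow> 'a::real_normed_vector"
  assumes c: "summable c" "\<And>k. 0 \<le> c k"
    and S: "\<And>k R. K \<le> k \<Longrightarrow> 2 ^ k \<le> R \<Longrightarrow> R \<le> 2 * 2 ^ k \<Longrightarrow> norm (S R - S (2 ^ k)) \<le> c k"
    and R: "2 ^ K \<le> R"
  shows "norm (S R - S (2 ^ K)) \<le> (\<Sum>k. c (k + K))"
proof -
  have partial: "norm (S R - S (2 ^ K)) \<le> (\<Sum>k\<le>n. c (k + K))"
    if "2 ^ (n + K) \<le> R" "R \<le> 2 * 2 ^ (n + K)" for n R
    using that
  proof (induction n arbitrary: R)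
    case 0
    then show ?case using S[of K R] by simp
  next
    case (Suc n)
    have "norm (S (2 ^ (Suc n + K)) - S (2 ^ K)) \<le> (\<Sum>k\<le>n. c (k + K))"
      by (rule Suc.IH) simp_all
    moreover have "norm (S R - S (2 ^ (Suc n + K))) \<le> c (Suc n + K)"
      using Suc.prems by (intro S) auto
    moreover have "norm (S R - S (2 ^ K)) \<le> norm (S R - S (2 ^ (Suc n + K))) + norm (S (2 ^ (Suc n + K)) - S (2 ^ K))"
      using norm_triangle_ineq[of "S R - S (2 ^ (Suc n + K))" "S (2 ^ (Suc n + K)) - S (2 ^ K)"] by simp
    ultimately show ?case by simp
  qed
  obtain n0 where n0: "R < 2 ^ n0" using real_arch_pow[of 2 R] by auto
  \<comment> \<open>The least such \<open>n\<close> also satisfies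
    \<open>2 ^ (n + K) \<le> R\<close>: for \<open>n = 0\<close> this is the assumption on
    \<open>R\<close>, otherwise it is minimality.\<close>
  define n where "n = (LEAST n. R \<le> 2 * 2 ^ (n + K))"
  have ex: "R \<le> 2 * 2 ^ (n0 + K)"
  proof -
    have "(2::real) ^ n0 \<le> 2 ^ Suc (n0 + K)" by (rule power_increasing) auto
    then show ?thesis using n0 by simp
  qed
  have n1: "R \<le> 2 * 2 ^ (n + K)" unfolding n_def by (rule LeastI[of _ n0]) (rule ex)
  have n2: "2 ^ (n + K) \<le> R"
  proof (cases n)
    case 0
    then show ?thesis using R by simp
  next
    case (Suc l)
    then have "\<not> R \<le> 2 * 2 ^ (l + K)" using not_less_Least[of l "\<lambda>n. R \<le> 2 * 2 ^ (n + K)"] unfolding n_def by auto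
    then show ?thesis using Suc by simp
  qed
  have "norm (S R - S (2 ^ K)) \<le> (\<Sum>k\<le>n. c (k + K))" by (rule partial[OF n2 n1])
  also have "\<dots> \<le> (\<Sum>k. c (k + K))"
    using c by (intro sum_le_suminf summable_ignore_initial_segment) auto
  finally show ?thesis .
qed

text \<open>Completeness gives a uniform limit along the powers of 2. The bounds inside the bands
  extend the convergence to all real \<open>R\<close>.\<close>

lemma uniform_limit_dyadic:
  fixes S :: "'b \<Rightarrow> real \<Rightarrow> 'a::banach"
  assumes c: "summable c" "\<And>k. 0 \<le> c k"
    and S: "\<And>t k R. t \<in> I \<Longrightarrow> K0 \<le> k \<Longrightarrow> 2 ^ k \<le> R \<Longrightarrow> R \<le> 2 * 2 ^ k \<Longrightarrow> norm (S t R - S t (2 ^ k)) \<le> c k"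
  obtains u where "uniform_limit I (\<lambda>R t. S t R) u at_top"
proof -
  define \<epsilon> where "\<epsilon> K = (\<Sum>k. c (k + K))" for K
  have \<epsilon>: "\<epsilon> \<longlonglongrightarrow> 0" unfolding \<epsilon>_def by (rule suminf_exist_split2[OF c(1)])
  have bd: "norm (S t R - S t (2 ^ K)) \<le> \<epsilon> K" if "t \<in> I" "K0 \<le> K" "2 ^ K \<le> R" for t K R
    unfolding \<epsilon>_def by (rule dyadic_telescope_bound[OF c _ that(3)]) (use S that in auto)
  have bd2: "norm (S t R - S t R') \<le> 2 * \<epsilon> K" if "t \<in> I" "K0 \<le> K" "2 ^ K \<le> R" "2 ^ K \<le> R'" for t K R R'
    using bd[of t K R] bd[of t K R'] that norm_triangle_ineq4[of "S t R - S t (2 ^ K)" "S t R' - S t (2 ^ K)"] by simp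
  have "uniformly_convergent_on I (\<lambda>n t. S t (2 ^ n))"
  proof (rule Cauchy_uniformly_convergent, rule uniformly_Cauchy_onI)
    fix e :: real assume "0 < e"
    then have "\<forall>\<^sub>F K in sequentially. \<epsilon> K < e / 2" using \<epsilon> by (intro order_tendstoD) auto
    then have "\<forall>\<^sub>F K in sequentially. \<epsilon> K < e / 2 \<and> K0 \<le> K"
      using eventually_ge_at_top by (rule eventually_conj)
    then obtain K where K: "\<epsilon> K < e / 2" "K0 \<le> K" by (auto simp: eventually_sequentially)
    show "\<exists>M. \<forall>t\<in>I. \<forall>i\<ge>M. \<forall>n\<ge>M. dist (S t (2 ^ i)) (S t (2 ^ n)) < e"
    proof (intro exI ballI allI impI)
      fix t i n assume "t \<in> I" "K \<le> i" "K \<le> n"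
      then have "norm (S t (2 ^ i) - S t (2 ^ n)) \<le> 2 * \<epsilon> K"
        using K by (intro bd2) (auto intro: power_increasing)
      then show "dist (S t (2 ^ i)) (S t (2 ^ n)) < e" using K by (simp add: dist_norm)
    qed
  qed
  then obtain u where u: "uniform_limit I (\<lambda>n t. S t (2 ^ n)) u sequentially"
    by (auto simp: uniformly_convergent_on_def)
  have "uniform_limit I (\<lambda>R t. S t R) u at_top"
  proof (rule uniform_limitI)
    fix e :: real assume "0 < e"
    have "\<forall>\<^sub>F K in sequentially. \<epsilon> K < e / 2" using \<epsilon> \<open>0 < e\<close> by (intro order_tendstoD) auto
    moreover have "\<forall>\<^sub>F K in sequentially. \<forall>t\<in>I. dist (S t (2 ^ K)) (u t) < e / 2"
      using u \<open>0 < e\<close> by (intro uniform_limitD) auto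
    moreover have "\<forall>\<^sub>F K in sequentially. K0 \<le> K" by (rule eventually_ge_at_top)
    ultimately have "\<forall>\<^sub>F K in sequentially. \<epsilon> K < e / 2 \<and> (\<forall>t\<in>I. dist (S t (2 ^ K)) (u t) < e / 2) \<and> K0 \<le> K"
      by eventually_elim auto
    then obtain K where K: "\<epsilon> K < e / 2" "\<And>t. t \<in> I \<Longrightarrow> dist (S t (2 ^ K)) (u t) < e / 2" "K0 \<le> K"
      by (auto simp: eventually_sequentially)
    show "\<forall>\<^sub>F R in at_top. \<forall>t\<in>I. dist (S t R) (u t) < e"
      using eventually_ge_at_top[of "2 ^ K"]
    proof eventually_elim
      case (elim R)
      show ?case
      proof
        fix t assume "t \<in> I"
        then have "dist (S t R) (S t (2 ^ K)) < e / 2"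
          using bd[of t K R] K(1,3) elim by (simp add: dist_norm)
        then show "dist (S t R) (u t) < e"
          using K(2)[OF \<open>t \<in> I\<close>] dist_triangle[of "S t R" "u t" "S t (2 ^ K)"] by linarith
      qed
    qed
  qed
  then show ?thesis by (rule that)
qed

text \<open>The outer radius \<open>R\<close> varies over the whole band because the solution is a
  limit over all real truncation radii, not only over powers of 2.\<close>

definition level_set :: "real \<Rightarrow> (real \<Rightarrow> complex) \<Rightarrow> real \<Rightarrow> nat \<Rightarrow> real set" where
  "level_set m g \<kappa> k = {x. \<exists>t R. \<bar>t\<bar> \<le> 1 \<and> 2 ^ k \<le> R \<and> R \<le> 2 * 2 ^ k \<and>
      \<kappa> \<le> norm (LINT \<xi>:annulus (2 ^ k) R|lebesgue. wave m x t \<xi> * g \<xi>)}"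

text \<open>If the bands contribute at most \<open>c k\<close> uniformly for
  \<open>\<bar>t\<bar> \<le> 1\<close>, the truncations, each continuous in \<open>t\<close>,
  converge uniformly. The limit then exists for all these times and is continuous at 0.\<close>

lemma convergence_off_level_sets:
  fixes f :: "real \<Rightarrow> complex"
  assumes g: "fourier f \<in> borel_measurable lebesgue" "integrable lebesgue (\<lambda>\<xi>. (norm (fourier f \<xi>))\<^sup>2)"
    and rep: "canonical_representative f"
    and c: "summable c" "\<And>k. 0 \<le> c k"
    and x: "\<And>k. K0 \<le> k \<Longrightarrow> x \<notin> level_set m (fourier f) (c k) k"
  shows "x \<notin> divergence_set m f"
proof -
  define S where "S t R = (LINT \<xi>:annulus (- 1) R|lebesgue. wave m x t \<xi> * fourier f \<xi>)" for t R
  have diff: "S t R - S t (2 ^ k) = (LINT \<xi>:annulus (2 ^ k) R|lebesgue. wave m x t \<xi> * fourier f \<xi>)"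
    if "2 ^ k \<le> R" for t R :: real and k
    unfolding S_def using that
    by (subst annulus_integral_split[of "- 1" "2 ^ k" R]) (auto intro!: wave_mult_integrable g intro: order_trans[of _ 0])
  obtain u where u: "uniform_limit {-1..1} (\<lambda>R t. S t R) u at_top"
  proof (rule uniform_limit_dyadic[OF c])
    fix t R :: real and k assume t: "t \<in> {-1..1}" and k: "K0 \<le> k" and R: "2 ^ k \<le> R" "R \<le> 2 * 2 ^ k"
    show "norm (S t R - S t (2 ^ k)) \<le> c k"
    proof (rule ccontr)
      assume "\<not> norm (S t R - S t (2 ^ k)) \<le> c k"
      then have "c k \<le> norm (LINT \<xi>:annulus (2 ^ k) R|lebesgue. wave m x t \<xi> * fourier f \<xi>)"
        unfolding diff[OF R(1)] by linarith
      then have "x \<in> level_set m (fourier f) (c k) k"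
        using t R unfolding level_set_def by (intro CollectI exI[of _ t] exI[of _ R]) auto
      then show False using x[OF k] by contradiction
    qed
  qed
  have lim: "((\<lambda>R. S t R) \<longlongrightarrow> u t) at_top" if "\<bar>t\<bar> \<le> 1" for t
    by (rule tendsto_uniform_limitI[OF u]) (use that in auto)
  have "continuous_on {-1..1} u"
    by (rule uniform_limit_theorem[OF _ u])
      (auto simp: S_def intro!: always_eventually annulus_integral_wave_continuous g)
  then have "(u \<longlongrightarrow> u 0) (at 0 within {-1..1})" by (auto simp: continuous_on_def)
  moreover have "at 0 within {-1..1} = at (0::real)"
    by (rule at_within_interior) (simp add: interior_atLeastAtMost_real)
  ultimately have cont: "(u \<longlongrightarrow> u 0) (at 0)" by simp
  define v where "v t = (1 / (2 * pi)) *\<^sub>R u t" for t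
  have sol: "has_solution_value m f x t (v t)" if "\<bar>t\<bar> \<le> 1" for t
  proof -
    have "(LINT \<xi>:cball 0 R|lebesgue. cis (x \<bullet> \<xi>) * (cis (t * norm \<xi> powr m) * fourier f \<xi>)) = S t R" for R
      unfolding S_def cball_eq_annulus by (simp add: wave_def cis_mult[symmetric] mult.assoc)
    then show ?thesis
      unfolding has_solution_value_def has_inverse_fourier_def v_def
      by (simp only: DIM_real power_one_right) (intro tendsto_intros lim that)
  qed
  \<comment> \<open>At \<open>t = 0\<close> the solution formula is the Fourier inversion formula,
    whose value the canonical representative takes.\<close>
  have "f x = v 0"
    using sol[of 0] rep unfolding has_solution_value_def canonical_representative_def by simp
  moreover have "(v \<longlongrightarrow> v 0) (at 0)" unfolding v_def by (intro tendsto_intros cont)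
  moreover have "\<forall>\<^sub>F t in at 0. has_solution_value m f x t (v t)"
  proof -
    have "\<forall>\<^sub>F t in at (0::real). t \<in> {-1<..<1}"
      by (rule eventually_at_in_open') auto
    then show ?thesis by eventually_elim (rule sol, auto)
  qed
  ultimately show ?thesis by (auto simp: divergence_set_def)
qed

section \<open>Sobolev energy of the bands and the Borel-Cantelli argument\<close>

lemma sobolev_fourier:
  fixes f :: "real \<Rightarrow> complex"
  assumes "f \<in> sobolev s" "0 < s"
  shows "fourier f \<in> borel_measurable lebesgue"
    and "integrable lebesgue (\<lambda>\<xi>. (1 + \<xi>\<^sup>2) powr s * (norm (fourier f \<xi>))\<^sup>2)"
    and "integrable lebesgue (\<lambda>\<xi>. (norm (fourier f \<xi>))\<^sup>2)"
proof -
  define G where "G \<xi> = (1 + (norm \<xi>)\<^sup>2) powr (s / 2) * fourier f \<xi>" for \<xi>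
  have G: "G \<in> borel_measurable lebesgue" "integrable lebesgue (\<lambda>\<xi>. (norm (G \<xi>))\<^sup>2)"
    using assms(1) by (simp_all add: sobolev_def square_integrable_def G_def[abs_def])
  have pos: "0 < 1 + \<xi>\<^sup>2" for \<xi> :: real by (simp add: add_pos_nonneg)
  \<comment> \<open>Membership in the Sobolev space gives measurability of the weighted transform
    \<open>G\<close>; division by the positive weight transfers it to
    \<open>fourier f\<close>.\<close>
  have eq: "fourier f = (\<lambda>\<xi>. complex_of_real ((1 + \<xi>\<^sup>2) powr (- (s / 2))) * G \<xi>)"
  proof
    fix \<xi> :: real
    have "(1 + \<xi>\<^sup>2) powr (- (s / 2)) * (1 + \<xi>\<^sup>2) powr (s / 2) = 1"
      using pos[of \<xi>] by (simp add: powr_add[symmetric])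
    then have "complex_of_real ((1 + \<xi>\<^sup>2) powr (- (s / 2))) * complex_of_real ((1 + \<xi>\<^sup>2) powr (s / 2)) = 1"
      by (simp only: of_real_mult[symmetric] of_real_1)
    then show "fourier f \<xi> = complex_of_real ((1 + \<xi>\<^sup>2) powr (- (s / 2))) * G \<xi>"
      by (simp add: G_def mult.assoc[symmetric])
  qed
  have "(\<lambda>\<xi>::real. complex_of_real ((1 + \<xi>\<^sup>2) powr (- (s / 2)))) \<in> borel_measurable lebesgue"
    by (rule measurable_completion) measurable
  then show meas: "fourier f \<in> borel_measurable lebesgue"
    by (subst eq) (intro borel_measurable_times G)
  have "(norm (G \<xi>))\<^sup>2 = (1 + \<xi>\<^sup>2) powr s * (norm (fourier f \<xi>))\<^sup>2" for \<xi>
  proof -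
    have "((1 + \<xi>\<^sup>2) powr (s / 2))\<^sup>2 = (1 + \<xi>\<^sup>2) powr s"
      by (simp add: power2_eq_square powr_add[symmetric])
    then show ?thesis by (simp add: G_def norm_mult power_mult_distrib)
  qed
  then show int: "integrable lebesgue (\<lambda>\<xi>. (1 + \<xi>\<^sup>2) powr s * (norm (fourier f \<xi>))\<^sup>2)"
    using G(2) by simp
  show "integrable lebesgue (\<lambda>\<xi>. (norm (fourier f \<xi>))\<^sup>2)"
  proof (rule Bochner_Integration.integrable_bound[OF int])
    show "(\<lambda>\<xi>. (norm (fourier f \<xi>))\<^sup>2) \<in> borel_measurable lebesgue" using meas by measurable
    have "1 * (norm (fourier f \<xi>))\<^sup>2 \<le> (1 + \<xi>\<^sup>2) powr s * (norm (fourier f \<xi>))\<^sup>2" for \<xi>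
      using assms(2) by (intro mult_right_mono ge_one_powr_ge_zero) auto
    then show "AE \<xi> in lebesgue. norm ((norm (fourier f \<xi>))\<^sup>2) \<le> norm ((1 + \<xi>\<^sup>2) powr s * (norm (fourier f \<xi>))\<^sup>2)"
      by (intro AE_I2) simp
  qed
qed

text \<open>On the annulus the Sobolev weight is at least \<open>N powr (2 * s)\<close>; this is the
  gain that competes with the growth exponent \<open>\<gamma>\<close> of the row sums.\<close>

lemma annulus_energy_bound:
  fixes g :: "real \<Rightarrow> complex" and N b s :: real
  assumes g: "g \<in> borel_measurable lebesgue" "integrable lebesgue (\<lambda>\<xi>. (1 + \<xi>\<^sup>2) powr s * (norm (g \<xi>))\<^sup>2)"
    and "0 < N" "0 < s"
  defines "h \<equiv> \<lambda>\<xi>. indicator (annulus N b) \<xi> *\<^sub>R g \<xi>"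
  shows "h \<in> borel_measurable lebesgue" "integrable lebesgue (\<lambda>\<xi>. (norm (h \<xi>))\<^sup>2)"
    "(LINT \<xi>|lebesgue. (norm (h \<xi>))\<^sup>2) \<le> N powr (- 2 * s) * (LINT \<xi>|lebesgue. (1 + \<xi>\<^sup>2) powr s * (norm (g \<xi>))\<^sup>2)"
proof -
  show meas: "h \<in> borel_measurable lebesgue"
    unfolding h_def using annulus_measurable g(1) by (intro borel_measurable_scaleR borel_measurable_indicator) auto
  have le: "(norm (h \<xi>))\<^sup>2 \<le> N powr (- 2 * s) * ((1 + \<xi>\<^sup>2) powr s * (norm (g \<xi>))\<^sup>2)" for \<xi>
  proof (cases "\<xi> \<in> annulus N b")
    case True
    then have "N\<^sup>2 \<le> \<xi>\<^sup>2" using \<open>0 < N\<close> by (simp add: abs_le_square_iff[symmetric] annulus_def)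
    then have "(N\<^sup>2) powr s \<le> (1 + \<xi>\<^sup>2) powr s" using \<open>0 < s\<close> by (intro powr_mono2) auto
    moreover have "(N\<^sup>2) powr s = N powr (2 * s)"
      using \<open>0 < N\<close> by (simp add: powr_powr flip: powr_numeral)
    ultimately have "N powr (- 2 * s) * N powr (2 * s) \<le> N powr (- 2 * s) * (1 + \<xi>\<^sup>2) powr s"
      by (intro mult_left_mono) auto
    moreover have "N powr (- 2 * s) * N powr (2 * s) = 1"
      using \<open>0 < N\<close> by (simp add: powr_add[symmetric])
    ultimately have "1 \<le> N powr (- 2 * s) * (1 + \<xi>\<^sup>2) powr s" by simp
    then have "1 * (norm (g \<xi>))\<^sup>2 \<le> (N powr (- 2 * s) * (1 + \<xi>\<^sup>2) powr s) * (norm (g \<xi>))\<^sup>2"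
      by (intro mult_right_mono) auto
    then show ?thesis using True by (simp add: h_def mult.assoc)
  qed (auto simp: h_def)
  show int: "integrable lebesgue (\<lambda>\<xi>. (norm (h \<xi>))\<^sup>2)"
  proof (rule Bochner_Integration.integrable_bound[OF integrable_mult_right[OF g(2)]])
    show "(\<lambda>\<xi>. (norm (h \<xi>))\<^sup>2) \<in> borel_measurable lebesgue" using meas by measurable
    show "AE \<xi> in lebesgue. norm ((norm (h \<xi>))\<^sup>2) \<le> norm (N powr (- 2 * s) * ((1 + \<xi>\<^sup>2) powr s * (norm (g \<xi>))\<^sup>2))"
      using le by (intro AE_I2) simp
  qed
  have "(LINT \<xi>|lebesgue. (norm (h \<xi>))\<^sup>2) \<le> (LINT \<xi>|lebesgue. N powr (- 2 * s) * ((1 + \<xi>\<^sup>2) powr s * (norm (g \<xi>))\<^sup>2))"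
    by (intro integral_mono int integrable_mult_right g(2) le)
  then show "(LINT \<xi>|lebesgue. (norm (h \<xi>))\<^sup>2) \<le> N powr (- 2 * s) * (LINT \<xi>|lebesgue. (1 + \<xi>\<^sup>2) powr s * (norm (g \<xi>))\<^sup>2)"
    by simp
qed

lemma hausdorff_measure_divergence_set_eq_0:
  fixes f :: "real \<Rightarrow> complex" and a m s :: real
  assumes m: "0 < m" "m < 1" and s: "0 < s" and a: "0 < a" "a < 1"
    and crit: "1 - a < 2 * s" "1/2 - (1 - m) * (a - 1/2) < 2 * s"
    and f: "f \<in> sobolev s" "canonical_representative f"
  shows "hausdorff_measure a (divergence_set m f) = 0"
proof -
  define \<gamma> where "\<gamma> = max (1 - a) (1/2 - (1 - m) * (a - 1/2))"
  have \<gamma>: "1 - a \<le> \<gamma>" "1/2 - (1 - m) * (a - 1/2) \<le> \<gamma>" "\<gamma> < 2 * s"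
    using crit by (auto simp: \<gamma>_def)
  \<comment> \<open>The gap \<open>2 * s - \<gamma>\<close> is \<open>4 * \<eta>\<close>. Thresholds
    \<open>q ^ k\<close> with \<open>q = 2 powr (- \<eta>)\<close> are summable and cost
    \<open>2 * \<eta>\<close> through the division by their squares. The remaining
    \<open>2 * \<eta>\<close> makes the contents decay like \<open>(q^2) ^ k\<close>, up to a factor
    linear in \<open>k\<close>.\<close>
  define \<eta> where "\<eta> = (2 * s - \<gamma>) / 4"
  have \<eta>: "0 < \<eta>" using \<gamma>(3) by (simp add: \<eta>_def)
  define q where "q = 2 powr (- \<eta>)"
  have q: "0 < q" "q < 1" using \<eta> powr_less_mono[of "- \<eta>" 0 2] by (auto simp: q_def)
  note g = sobolev_fourier[OF f(1) s]
  define A where "A = (LINT \<xi>|lebesgue. (1 + \<xi>\<^sup>2) powr s * (norm (fourier f \<xi>))\<^sup>2)"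
  define F where "F k = level_set m (fourier f) (q ^ k) k" for k
  define c where "c k = A * schur_const m * (real (Suc k) * (q\<^sup>2) ^ k)" for k
  have "summable (\<lambda>k. real (Suc k) * (q\<^sup>2) ^ k)"
  proof (rule sums_summable[OF geometric_deriv_sums])
    show "norm (q\<^sup>2) < 1" using q by (simp add: power_less_one_iff abs_square_less_1)
  qed
  then have c: "summable c" unfolding c_def by (rule summable_mult)
  have off: "divergence_set m f \<subseteq> (\<Union>k. F (k + K))" for K
  proof
    fix x assume x: "x \<in> divergence_set m f"
    show "x \<in> (\<Union>k. F (k + K))"
    proof (rule ccontr)
      assume no: "x \<notin> (\<Union>k. F (k + K))"
      have "x \<notin> divergence_set m f"
      proof (rule convergence_off_level_sets[OF g(1,3) f(2), of "\<lambda>k. q ^ k"])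
        show "x \<notin> level_set m (fourier f) (q ^ k) k" if "K \<le> k" for k
          using no that by (auto simp: F_def dest: spec[of _ "k - K"])
      qed (use q in \<open>auto intro!: summable_geometric\<close>)
      then show False using x by contradiction
    qed
  qed
  \<comment> \<open>Fixing the integer part keeps distances below 1, as the covering lemma requires.
    The bound \<open>c k\<close> does not depend on the piece, and there are countably many
    pieces.\<close>
  have cover: "\<exists>T. finite T \<and> (\<forall>(c,r)\<in>T. 0 < r) \<and> F k \<inter> {x. \<lfloor>x\<rfloor> = z} \<subseteq> (\<Union>(c,r)\<in>T. ball c (6 * r))
      \<and> (\<Sum>(c,r)\<in>T. r powr a) \<le> c k" for k z
  proof -
    \<comment> \<open>Restricting the transform to the band leaves the integrals over its parts
      unchanged and brings in the decay \<open>(2 ^ k) powr (- 2 * s)\<close> of the energy.\<close>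
    define h where "h \<xi> = indicator (annulus (2 ^ k) (2 * 2 ^ k)) \<xi> *\<^sub>R fourier f \<xi>" for \<xi>
    have h: "h \<in> borel_measurable lebesgue" "integrable lebesgue (\<lambda>\<xi>. (norm (h \<xi>))\<^sup>2)"
      "(LINT \<xi>|lebesgue. (norm (h \<xi>))\<^sup>2) \<le> (2 ^ k) powr (- 2 * s) * A"
      using annulus_energy_bound[OF g(1,2) _ s, of "2 ^ k" "2 * 2 ^ k"] unfolding h_def[abs_def] A_def by simp_all
    obtain T where T: "finite T" "\<And>c r. (c, r) \<in> T \<Longrightarrow> 0 < r"
      "F k \<inter> {x. \<lfloor>x\<rfloor> = z} \<subseteq> (\<Union>(c,r)\<in>T. ball c (6 * r))"
      "(\<Sum>(c,r)\<in>T. r powr a) \<le> ((2 ^ k) powr (- 2 * s) * A) * (schur_const m * real (k + 1) * 2 powr (real k * \<gamma>)) / (q ^ k)\<^sup>2"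
    proof (rule level_set_cover[OF a m _ \<gamma>(1,2) h, of "q ^ k" "F k \<inter> {x. \<lfloor>x\<rfloor> = z}" k])
      show "\<bar>x - y\<bar> < 1" if "x \<in> F k \<inter> {x. \<lfloor>x\<rfloor> = z}" "y \<in> F k \<inter> {x. \<lfloor>x\<rfloor> = z}" for x y
        using that by (simp add: floor_eq_iff) linarith
      fix x assume "x \<in> F k \<inter> {x. \<lfloor>x\<rfloor> = z}"
      then obtain t R where tR: "\<bar>t\<bar> \<le> 1" "2 ^ k \<le> R" "R \<le> 2 * 2 ^ k"
        "q ^ k \<le> norm (LINT \<xi>:annulus (2 ^ k) R|lebesgue. wave m x t \<xi> * fourier f \<xi>)"
        by (auto simp: F_def level_set_def)
      have "(LINT \<xi>:annulus (2 ^ k) R|lebesgue. wave m x t \<xi> * h \<xi>)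
          = (LINT \<xi>:annulus (2 ^ k) R|lebesgue. wave m x t \<xi> * fourier f \<xi>)"
        unfolding set_lebesgue_integral_def h_def using tR(3)
        by (intro Bochner_Integration.integral_cong) (auto simp: indicator_def annulus_def)
      then show "\<exists>t R. \<bar>t\<bar> \<le> 1 \<and> 2 ^ k \<le> R \<and> R \<le> 2 * 2 ^ k \<and>
          q ^ k \<le> norm (LINT \<xi>:annulus (2 ^ k) R|lebesgue. wave m x t \<xi> * h \<xi>)"
        using tR by (intro exI[of _ t] exI[of _ R]) auto
    qed (use q in auto)
    have "(2 ^ k) powr (- 2 * s) * 2 powr (real k * \<gamma>) / (q ^ k)\<^sup>2 = (q\<^sup>2) ^ k"
    proof -
      have qk: "q ^ n = 2 powr (- real n * \<eta>)" for n
        using q by (simp add: q_def powr_realpow[symmetric] powr_powr mult.commute)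
      have "(q ^ k)\<^sup>2 = q ^ (k * 2)" "(q\<^sup>2) ^ k = q ^ (2 * k)" by (simp_all only: power_mult)
      then have e: "(q ^ k)\<^sup>2 = 2 powr (- 2 * real k * \<eta>)" "(q\<^sup>2) ^ k = 2 powr (- 2 * real k * \<eta>)"
        by (simp_all add: qk mult_ac)
      have "((2::real) ^ k) powr (- 2 * s) = 2 powr (- 2 * s * real k)"
        by (simp add: powr_realpow[symmetric] powr_powr mult.commute)
      then have "(2 ^ k) powr (- 2 * s) * 2 powr (real k * \<gamma>) / (q ^ k)\<^sup>2
          = 2 powr (- 2 * s * real k + real k * \<gamma> - - 2 * real k * \<eta>)"
        unfolding e powr_add powr_diff by simp
      also have "- 2 * s * real k + real k * \<gamma> - - 2 * real k * \<eta> = - 2 * real k * \<eta>"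
        by (simp add: \<eta>_def field_simps)
      finally show ?thesis unfolding e .
    qed
    moreover have "((2 ^ k) powr (- 2 * s) * A) * (schur_const m * real (k + 1) * 2 powr (real k * \<gamma>)) / (q ^ k)\<^sup>2
        = A * schur_const m * (real (Suc k) * ((2 ^ k) powr (- 2 * s) * 2 powr (real k * \<gamma>) / (q ^ k)\<^sup>2))"
      by simp
    ultimately have "((2 ^ k) powr (- 2 * s) * A) * (schur_const m * real (k + 1) * 2 powr (real k * \<gamma>)) / (q ^ k)\<^sup>2 = c k"
      by (simp only: c_def)
    then show ?thesis using T by (intro exI[of _ T]) auto
  qed
  have piece: "hausdorff_measure a (divergence_set m f \<inter> {x. \<lfloor>x\<rfloor> = z}) = 0" for z
  proof (rule hausdorff_measure_limsup_eq_0[OF a(1) c, of "\<lambda>k. F k \<inter> {x. \<lfloor>x\<rfloor> = z}"])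
    show "divergence_set m f \<inter> {x. \<lfloor>x\<rfloor> = z} \<subseteq> (\<Union>k. F (k + K) \<inter> {x. \<lfloor>x\<rfloor> = z})" for K
      using off[of K] by blast
  qed (rule cover)
  have "divergence_set m f = (\<Union>n. divergence_set m f \<inter> {x. \<lfloor>x\<rfloor> = from_nat n})"
    by (auto intro!: exI[of _ "to_nat \<lfloor>x\<rfloor>" for x])
  then show ?thesis using hausdorff_measure_UN_eq_0[OF piece, of from_nat] by simp
qed

theorem theorem1:
  fixes m s :: real
  assumes "0 < m" and "m < 1"
    and "m / 4 < s" and "s < 1 / 2"
  shows "(SUP f\<in>{f :: real \<Rightarrow> complex. f \<in> sobolev s \<and> canonical_representative f}.
            hausdorff_dim (divergence_set m f))
         \<le> ereal (max (1 - 2 * s) (1 / 2 + (1 - 4 * s) / (2 * (1 - m))))"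
proof (rule SUP_least)
  fix f :: "real \<Rightarrow> complex"
  assume "f \<in> {f. f \<in> sobolev s \<and> canonical_representative f}"
  then have f: "f \<in> sobolev s" "canonical_representative f" by auto
  define \<beta> where "\<beta> = max (1 - 2 * s) (1 / 2 + (1 - 4 * s) / (2 * (1 - m)))"
  have s: "0 < s" using assms by linarith
  \<comment> \<open>Equivalent to \<open>m / 4 < s\<close>. With \<open>0 < s\<close> it gives
    \<open>\<beta> < 1\<close>, so exponents \<open>a\<close> strictly between
    \<open>\<beta>\<close> and 1 exist; \<open>s < 1/2\<close> gives
    \<open>0 < \<beta>\<close>.\<close>
  have "(1 - 4 * s) / (2 * (1 - m)) < 1 / 2" using assms by (simp add: field_simps)
  then have \<beta>: "0 < \<beta>" "\<beta> < 1"
    using assms(4) s unfolding \<beta>_def less_max_iff_disj max_less_iff_conj by linarith+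
  have bound: "hausdorff_dim (divergence_set m f) \<le> ereal a" if a: "\<beta> < a" "a < 1" for a
  proof -
    have "1 - a < 2 * s" "(1 - 4 * s) / (2 * (1 - m)) < a - 1 / 2" using a by (auto simp: \<beta>_def)
    moreover from this(2) have "1 / 2 - (1 - m) * (a - 1 / 2) < 2 * s" using assms by (simp add: field_simps)
    ultimately have "hausdorff_measure a (divergence_set m f) = 0"
      using a \<beta> by (intro hausdorff_measure_divergence_set_eq_0[OF assms(1,2) s _ _ _ _ f]) auto
    then show ?thesis unfolding hausdorff_dim_def using a \<beta> by (intro INF_lower) auto
  qed
  have "hausdorff_dim (divergence_set m f) \<le> ereal \<beta>"
  proof (rule ccontr)
    assume "\<not> hausdorff_dim (divergence_set m f) \<le> ereal \<beta>"
    \<comment> \<open>The measure vanishes for all \<open>a\<close> in the open interval from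
      \<open>\<beta>\<close> to 1; taking the minimum with 1 makes the density argument choose
      \<open>a\<close> there.\<close>
    then have "ereal \<beta> < min (hausdorff_dim (divergence_set m f)) 1" using \<beta> by (simp add: not_le one_ereal_def)
    then obtain a where "ereal \<beta> < ereal a" "ereal a < min (hausdorff_dim (divergence_set m f)) 1"
      using ereal_dense2 by blast
    then show False using bound[of a] by (auto simp: one_ereal_def)
  qed
  then show "hausdorff_dim (divergence_set m f) \<le> ereal (max (1 - 2 * s) (1 / 2 + (1 - 4 * s) / (2 * (1 - m))))"
    by (simp add: \<beta>_def)
qed

end
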